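(* Let $m,n\in\mathbb{N}$ with $m,n\ge 2$, let $D=\{x\in\mathbb{R}^2:|x|<1\}$, and let $f^1,\dots,f^m\in C((0,1)\times(0,\infty)^m,\mathbb{R})$ be such that: (i) for each $i\in\{1,\dots,m\}$ and each $(u^1,\dots,u^m)\in(0,\infty)^m$, the map $r\mapsto r^{2-2n}f^i(r,u^1,\dots,u^m)$ from $(0,1)$ to $\mathbb{R}$ is nonincreasing; (ii) for each $i\in\{1,\dots,m\}$ and $r\in(0,1)$, $f^i(r,\cdot,\dots,\cdot)\in C^1((0,\infty)^m,\mathbb{R})$; (iii) for each $i,j\in\{1,\dots,m\}$ with $i\ne j$ and each $(r,u^1,\dots,u^m)\in(0,1)\times(0,\infty)^m$, $$\frac{\partial f^i}{\partial u^j}(r,u^1,\dots,u^m)\ge 0;$$ (iv) for each $i,j\in\{1,\dots,m\}$, $r_0\in(0,1)$ and $M\in(0,\infty)$, $$\sup\Big\{\Big|\frac{\partial f^i}{\partial u^j}(r,u^1,\dots,u^m)\Big|:(r,u^1,\dots,u^m)\in(r_0,1)\times(0,M]^m\Big\}<\infty.$$ Let $u^1,\dots,u^m\in C^2(D\setminus\{0\})\cap C(\overline{D})$ be such that, for every $i=1,\dots,m$, $$\Delta u^i(x)+f^i(|x|,u^1(x),\dots,u^m(x))=0\ \text{ for } x\in D\setminus\{0\},\qquad u^i=0\ \text{ on }\partial D,$$ and such that each $u^i$ is $n$-mode, positive in $D$, and of class $C^n$ at the origin. Then each $u^i$ is radially symmetric and, writing $u^i=u^i(r)$ with $r=|x|$,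 $\frac{\partial u^i}{\partial r}(r)<0$ for all $r\in(0,1)$.
   Context: A function $u:\overline{D}\to\mathbb{R}$ is called $n$-mode if, in polar coordinates, $u(r,\theta)=u(r,\theta+2\pi/n)$ for all $(r,\theta)\in[0,1]\times\mathbb{R}$ (invariance under rotation by $2\pi/n$ about the origin). A function $u$ is said to be of class $C^n$ at the origin if $u$ is of class $C^{n-1}$ in a neighborhood of the origin and each partial derivative of $u$ of order $n-1$ is totally (Fréchet) differentiable at the origin. Radially symmetric means that $u(x)$ depends only on $|x|$. *)

theory Defs
  imports "HOL-Analysis.Analysis"
begin

definition pderiv_at :: "'n::finite \<Rightarrow> (real ^ 'n \<Rightarrow> real) \<Rightarrow> real ^ 'n \<Rightarrow> real" where
  "pderiv_at j g x = deriv (\<lambda>t. g (x + t *\<^sub>R axis j 1)) 0"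

text \<open>The innermost derivative is the one with respect to the last index of the list.\<close>

primrec iter_pderiv :: "'n::finite list \<Rightarrow> (real ^ 'n \<Rightarrow> real) \<Rightarrow> real ^ 'n \<Rightarrow> real" where
  "iter_pderiv [] g = g"
| "iter_pderiv (j # js) g = pderiv_at j (iter_pderiv js g)"

text \<open>Class \<open>C\<^sup>k\<close>, meant for open \<open>S\<close>: all partial derivatives up to order \<open>k\<close> exist
  and are continuous. The existence clause is needed because \<^const>\<open>deriv\<close> is total.\<close>

primrec Ck_on :: "nat \<Rightarrow> (real ^ 'n::finite) set \<Rightarrow> (real ^ 'n \<Rightarrow> real) \<Rightarrow> bool" where
  "Ck_on 0 S g \<longleftrightarrow> continuous_on S g"
| "Ck_on (Suc k) S g \<longleftrightarrow> continuous_on S g \<and>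
     (\<forall>j. (\<forall>x\<in>S. (\<lambda>t::real. g (x + t *\<^sub>R axis j 1)) differentiable (at 0)) \<and>
          Ck_on k S (pderiv_at j g))"

text \<open>Class \<open>C\<^sup>k\<close> at the single point \<open>a\<close>, meant for \<open>k \<ge> 1\<close>; no derivative of order \<open>k\<close>
  is required to exist away from \<open>a\<close>.\<close>

definition Ck_at :: "nat \<Rightarrow> real ^ 'n::finite \<Rightarrow> (real ^ 'n \<Rightarrow> real) \<Rightarrow> bool" where
  "Ck_at k a g \<longleftrightarrow>
     (\<exists>U. open U \<and> a \<in> U \<and> Ck_on (k - 1) U g) \<and>
     (\<forall>js. length js = k - 1 \<longrightarrow> iter_pderiv js g differentiable (at a))"

definition laplacian :: "(real ^ 'n::finite \<Rightarrow> real) \<Rightarrow> real ^ 'n \<Rightarrow> real" where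
  "laplacian g x = (\<Sum>j\<in>UNIV. pderiv_at j (pderiv_at j g) x)"

definition polar :: "real \<Rightarrow> real \<Rightarrow> real ^ 2" where
  "polar r \<theta> = vector [r * cos \<theta>, r * sin \<theta>]"

definition n_mode :: "nat \<Rightarrow> (real ^ 2 \<Rightarrow> real) \<Rightarrow> bool" where
  "n_mode n g \<longleftrightarrow> (\<forall>r\<in>{0..1}. \<forall>\<theta>. g (polar r \<theta>) = g (polar r (\<theta> + 2 * pi / real n)))"

definition pos_orthant :: "(real ^ 'm::finite) set" where
  "pos_orthant = {v. \<forall>k. 0 < v $ k}"

end

theory Submission
  imports Defs "HOL-Complex_Analysis.Cauchy_Integral_Formula"
begin

text \<open>
  Since each \<open>u\<^sup>i\<close> is \<open>n\<close>-mode, \<open>u\<^sup>i(z) = V\<^sup>i(z\<^sup>n)\<close> for a function \<open>V\<^sup>i\<close> on the disc. As \<open>z \<mapsto> z\<^sup>n\<close> is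
  conformal off the origin, \<open>V\<close> solves \<open>\<Delta>V\<^sup>i + g\<^sup>i(|x|, V) = 0\<close> there, where
  \<open>g\<^sup>i(r\<^sup>n, v) = r\<^bsup>2-2n\<^esup> f\<^sup>i(r, v) / n\<^sup>2\<close> is nonincreasing in the radius, so the method of moving planes
  applies to \<open>V\<close>. The plane \<open>Re x = \<tau>\<close> is moved from \<open>\<tau> = 1\<close> towards \<open>0\<close>: once it is in an admissible
  position, the difference of \<open>V\<close> with its reflection is positive in the cap beyond the plane, hence
  bounded below away from the plane, and the maximum principle in the remaining narrow strip lets the
  plane advance. The reflected origin is a single interior point of the cap; a logarithmic barrier
  makes it negligible, so that continuity of \<open>V\<close> at the origin is enough. In the limit \<open>\<tau> = 0\<close>, in all
  directions, \<open>V\<close> is radial, and the boundary point lemma on the plane makes its radial derivative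
  negative.
\<close>

subsection \<open>Pointwise Laplacians\<close>

text \<open>Two obstacles shape the argument: the coupling and the origin. Components of the
  difference may pull each other down, but under cooperativity only their negative parts do so. As
  long as some component may be negative, all are handled at once through the most negative weighted
  value. Once all are nonnegative, the coupling drops out and each component satisfies a scalar
  inequality, to which the boundary point lemma applies separately. The Lipschitz constant of the
  nonlinearity is uniform only for radii bounded away from \<open>0\<close>. Points beyond the plane
  have radius above \<open>\<tau>\<close>, and monotonicity in the radius replaces the reflected
  radius by this larger one before the constant is used. Hence all planes with
  \<open>\<tau> \<ge> \<tau>0 > 0\<close> share one constant, and \<open>\<tau> = 0\<close> is
  reached only as a limit. The constant holds for values arbitrarily close to \<open>0\<close>, so
  the unit circle needs no separate analysis. The narrow strip ends no later than
  \<open>Re x = 2 * \<tau>\<close>, so the reflected origin matters only for the boundary point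
  lemma.\<close>

text \<open>A second-order Peano expansion at the point: every real quadratic form on the plane is
  \<open>Re (b h\<^sup>2) + L / 4 * |h|\<^sup>2\<close> with trace \<open>L\<close>. In this form the conformal change of variables and the
  maximum principle need neither neighbourhoods nor symmetry of mixed derivatives.\<close>

definition has_laplacian :: "(complex \<Rightarrow> real) \<Rightarrow> real \<Rightarrow> complex \<Rightarrow> bool" where
  "has_laplacian f L z \<longleftrightarrow> (\<exists>a b E. (E \<longlongrightarrow> 0) (nhds 0) \<and>
     (\<forall>\<^sub>F h in nhds 0. f (z + h) =
        f z + Re (a * h) + Re (b * h\<^sup>2) + L / 4 * (cmod h)\<^sup>2 + (cmod h)\<^sup>2 * E h))"

lemma Re_of_real_mult: "Re (complex_of_real r * w) = r * Re w"
  by simp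

lemma eventually_nhds_shift:
  fixes z :: "'a::real_normed_vector"
  assumes "eventually P (nhds z)"
  shows "\<forall>\<^sub>F h in nhds 0. P (z + h)"
proof -
  have "filterlim (\<lambda>h. z + h) (nhds (z + 0)) (nhds 0)"
    by (intro tendsto_intros filterlim_ident)
  then show ?thesis
    using assms by (simp add: filterlim_iff)
qed

lemma has_laplacian_cong:
  assumes "has_laplacian f L z" "\<forall>\<^sub>F x in nhds z. g x = f x"
  shows "has_laplacian g L z"
proof -
  obtain a b E where E: "(E \<longlongrightarrow> 0) (nhds 0)"
    and f: "\<forall>\<^sub>F h in nhds 0. f (z + h) =
        f z + Re (a * h) + Re (b * h\<^sup>2) + L / 4 * (cmod h)\<^sup>2 + (cmod h)\<^sup>2 * E h"
    using assms(1) unfolding has_laplacian_def by blast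
  have gz: "g z = f z"
    using assms(2) eventually_nhds_x_imp_x by fast
  have "\<forall>\<^sub>F h in nhds 0. g (z + h) =
        g z + Re (a * h) + Re (b * h\<^sup>2) + L / 4 * (cmod h)\<^sup>2 + (cmod h)\<^sup>2 * E h"
    using eventually_nhds_shift[OF assms(2)] f by eventually_elim (simp add: gz)
  with E show ?thesis
    unfolding has_laplacian_def by blast
qed

lemma has_laplacian_add:
  assumes "has_laplacian f L z" "has_laplacian g M z"
  shows "has_laplacian (\<lambda>x. f x + g x) (L + M) z"
proof -
  obtain a b E where E: "(E \<longlongrightarrow> 0) (nhds 0)"
    and f: "\<forall>\<^sub>F h in nhds 0. f (z + h) =
        f z + Re (a * h) + Re (b * h\<^sup>2) + L / 4 * (cmod h)\<^sup>2 + (cmod h)\<^sup>2 * E h"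
    using assms(1) unfolding has_laplacian_def by blast
  obtain a' b' E' where E': "(E' \<longlongrightarrow> 0) (nhds 0)"
    and g: "\<forall>\<^sub>F h in nhds 0. g (z + h) =
        g z + Re (a' * h) + Re (b' * h\<^sup>2) + M / 4 * (cmod h)\<^sup>2 + (cmod h)\<^sup>2 * E' h"
    using assms(2) unfolding has_laplacian_def by blast
  have "((\<lambda>h. E h + E' h) \<longlongrightarrow> 0) (nhds 0)"
    using tendsto_add[OF E E'] by simp
  moreover have "\<forall>\<^sub>F h in nhds 0. f (z + h) + g (z + h) =
        f z + g z + Re ((a + a') * h) + Re ((b + b') * h\<^sup>2) + (L + M) / 4 * (cmod h)\<^sup>2
        + (cmod h)\<^sup>2 * (E h + E' h)"
    using f g by eventually_elim (simp add: field_simps)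
  ultimately show ?thesis
    unfolding has_laplacian_def by blast
qed

lemma has_laplacian_cmult:
  assumes "has_laplacian f L z"
  shows "has_laplacian (\<lambda>x. c * f x) (c * L) z"
proof -
  obtain a b E where E: "(E \<longlongrightarrow> 0) (nhds 0)"
    and f: "\<forall>\<^sub>F h in nhds 0. f (z + h) =
        f z + Re (a * h) + Re (b * h\<^sup>2) + L / 4 * (cmod h)\<^sup>2 + (cmod h)\<^sup>2 * E h"
    using assms(1) unfolding has_laplacian_def by blast
  have "((\<lambda>h. c * E h) \<longlongrightarrow> 0) (nhds 0)"
    using tendsto_mult_left[OF E, of c] by simp
  moreover have "\<forall>\<^sub>F h in nhds 0. c * f (z + h) =
        c * f z + Re ((c * a) * h) + Re ((c * b) * h\<^sup>2) + (c * L) / 4 * (cmod h)\<^sup>2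
        + (cmod h)\<^sup>2 * (c * E h)"
    using f
  proof eventually_elim
    case (elim h)
    show ?case
      unfolding elim by (simp add: field_simps)
  qed
  ultimately show ?thesis
    unfolding has_laplacian_def by blast
qed

lemma has_laplacian_quadratic:
  "has_laplacian (\<lambda>x. c + Re (a * x) + Re (b * x\<^sup>2) + L / 4 * (cmod x)\<^sup>2) L z"
proof -
  have "c + Re (a * (z + h)) + Re (b * (z + h)\<^sup>2) + L / 4 * (cmod (z + h))\<^sup>2 =
      c + Re (a * z) + Re (b * z\<^sup>2) + L / 4 * (cmod z)\<^sup>2
      + Re ((a + 2 * b * z + L / 2 * cnj z) * h) + Re (b * h\<^sup>2) + L / 4 * (cmod h)\<^sup>2
      + (cmod h)\<^sup>2 * 0" for h
    unfolding cmod_power2 by (simp add: power2_eq_square field_simps)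
  then show ?thesis
    unfolding has_laplacian_def
    by (intro exI[of _ "a + 2 * b * z + L / 2 * cnj z"] exI[of _ b] exI[of _ "\<lambda>_. 0"]) simp
qed

lemma has_laplacian_cnj:
  assumes "has_laplacian f L (cnj z)"
  shows "has_laplacian (\<lambda>x. f (cnj x)) L z"
proof -
  obtain a b E where E: "(E \<longlongrightarrow> 0) (nhds 0)"
    and f: "\<forall>\<^sub>F h in nhds 0. f (cnj z + h) =
        f (cnj z) + Re (a * h) + Re (b * h\<^sup>2) + L / 4 * (cmod h)\<^sup>2 + (cmod h)\<^sup>2 * E h"
    using assms(1) unfolding has_laplacian_def by blast
  have lim: "filterlim cnj (nhds 0) (nhds 0)"
    by (rule tendsto_eq_intros filterlim_ident | simp)+
  have "((\<lambda>h. E (cnj h)) \<longlongrightarrow> 0) (nhds 0)"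
    by (rule filterlim_compose[OF E lim])
  moreover have "\<forall>\<^sub>F h in nhds 0. f (cnj (z + h)) =
        f (cnj z) + Re (cnj a * h) + Re (cnj b * h\<^sup>2) + L / 4 * (cmod h)\<^sup>2
        + (cmod h)\<^sup>2 * E (cnj h)"
    using eventually_compose_filterlim[OF f lim]
  proof eventually_elim
    case (elim h)
    have "Re (a * cnj h) = Re (cnj a * h)" "Re (b * (cnj h)\<^sup>2) = Re (cnj b * h\<^sup>2)"
      by (simp_all add: power2_eq_square)
    then show ?case
      by (simp only: elim complex_cnj_add complex_mod_cnj)
  qed
  ultimately show ?thesis
    unfolding has_laplacian_def
    by (intro exI[of _ "cnj a"] exI[of _ "cnj b"] exI[of _ "\<lambda>h. E (cnj h)"] conjI)
qed

text \<open>Put \<open>k = \<phi> (z + h) - \<phi> z\<close>. The terms \<open>Re (a * k)\<close>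
  and \<open>Re (b * k\<^sup>2)\<close> become real parts of complex polynomials in \<open>h\<close>
  up to a small error, so they add nothing to the trace. Only \<open>(cmod k)\<^sup>2\<close> does,
  and it picks up the conformal factor.\<close>

lemma has_laplacian_compose_holomorphic:
  assumes f: "has_laplacian f L (\<phi> z)" and hol: "\<phi> holomorphic_on S" and S: "open S" "z \<in> S"
  shows "has_laplacian (\<lambda>x. f (\<phi> x)) ((cmod (deriv \<phi> z))\<^sup>2 * L) z"
proof -
  \<comment> \<open>The difference quotient with its singularity removed is again holomorphic. Its
    derivative \<open>\<beta>\<close> is the second-order coefficient of \<open>\<phi>\<close> at
    \<open>z\<close>.\<close>
  define A where "A = (\<lambda>x. if x = z then deriv \<phi> z else (\<phi> x - \<phi> z) / (x - z))"
  define \<alpha> where "\<alpha> = deriv \<phi> z"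
  define \<beta> where "\<beta> = deriv A z"
  have "A holomorphic_on S"
    unfolding A_def using S hol by (intro pole_lemma) (auto simp: interior_open)
  then have dA: "(A has_field_derivative \<beta>) (at z)"
    using S holomorphic_derivI \<beta>_def by blast
  have \<phi>: "\<phi> (z + h) = \<phi> z + h * A (z + h)" for h
    by (simp add: A_def)
  have Az: "A z = \<alpha>"
    by (simp add: A_def \<alpha>_def)
  define Q where "Q = (\<lambda>h. if h = 0 then 0 else (A (z + h) - A z) / h - \<beta>)"
  have "((\<lambda>h. (A (z + h) - A z) / h) \<longlongrightarrow> \<beta>) (at 0)"
    using dA by (simp add: DERIV_def)
  then have "((\<lambda>h. (A (z + h) - A z) / h - \<beta>) \<longlongrightarrow> 0) (at 0)"
    by (simp add: LIM_zero)
  then have "(Q \<longlongrightarrow> 0) (at 0)"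
    by (rule Lim_transform_eventually) (auto simp: Q_def eventually_at_filter)
  then have Q: "(Q \<longlongrightarrow> 0) (nhds 0)"
    by (simp add: tendsto_nhds_iff Q_def)
  have A_eq: "A (z + h) = \<alpha> + \<beta> * h + h * Q h" for h
    by (simp add: Q_def Az field_simps)
  have id: "((\<lambda>h::complex. h) \<longlongrightarrow> 0) (nhds 0)"
    by (rule filterlim_ident)
  have A0: "((\<lambda>h. A (z + h)) \<longlongrightarrow> \<alpha>) (nhds 0)"
    unfolding A_eq using Q by (auto intro!: tendsto_eq_intros id)
  have k0: "filterlim (\<lambda>h. h * A (z + h)) (nhds 0) (nhds 0)"
    using A0 by (auto intro!: tendsto_eq_intros id)
  obtain a b E where E: "(E \<longlongrightarrow> 0) (nhds 0)"
    and f: "\<forall>\<^sub>F h in nhds 0. f (\<phi> z + h) =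
        f (\<phi> z) + Re (a * h) + Re (b * h\<^sup>2) + L / 4 * (cmod h)\<^sup>2 + (cmod h)\<^sup>2 * E h"
    using assms(1) unfolding has_laplacian_def by blast
  \<comment> \<open>The bounded factor \<open>u\<close> extracts the real weight
    \<open>(cmod h)\<^sup>2\<close> from complex multiples of \<open>h\<^sup>2\<close>, so that all
    errors fit into the single remainder \<open>F\<close>.\<close>
  define u where "u = (\<lambda>h. if h = 0 then 0 else h\<^sup>2 / (cmod h)\<^sup>2)"
  have u: "h\<^sup>2 = (cmod h)\<^sup>2 * u h" for h
    by (simp add: u_def)
  have u_le: "cmod (u h) \<le> 1" for h
    by (simp add: u_def norm_divide norm_power)
  define T where "T = (\<lambda>h. (a * Q h + b * ((A (z + h))\<^sup>2 - \<alpha>\<^sup>2)) * u h)"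
  define F where "F = (\<lambda>h. Re (T h) + L / 4 * ((cmod (A (z + h)))\<^sup>2 - (cmod \<alpha>)\<^sup>2)
     + (cmod (A (z + h)))\<^sup>2 * E (h * A (z + h)))"
  have "(T \<longlongrightarrow> 0) (nhds 0)"
    unfolding T_def
  proof (rule Lim_null_comparison)
    show "\<forall>\<^sub>F h in nhds 0. cmod ((a * Q h + b * ((A (z + h))\<^sup>2 - \<alpha>\<^sup>2)) * u h)
         \<le> cmod (a * Q h + b * ((A (z + h))\<^sup>2 - \<alpha>\<^sup>2))"
      using u_le by (auto simp: norm_mult intro!: always_eventually mult_left_le)
    show "((\<lambda>h. cmod (a * Q h + b * ((A (z + h))\<^sup>2 - \<alpha>\<^sup>2))) \<longlongrightarrow> 0) (nhds 0)"
      using A0 Q by (auto intro!: tendsto_eq_intros)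
  qed
  moreover have "((\<lambda>h. E (h * A (z + h))) \<longlongrightarrow> 0) (nhds 0)"
    using filterlim_compose[OF E k0] .
  ultimately have "(F \<longlongrightarrow> 0) (nhds 0)"
    unfolding F_def using A0 by (auto intro!: tendsto_eq_intros)
  moreover have "\<forall>\<^sub>F h in nhds 0. f (\<phi> (z + h)) = f (\<phi> z) + Re ((a * \<alpha>) * h)
      + Re ((a * \<beta> + b * \<alpha>\<^sup>2) * h\<^sup>2) + ((cmod \<alpha>)\<^sup>2 * L) / 4 * (cmod h)\<^sup>2 + (cmod h)\<^sup>2 * F h"
    using eventually_compose_filterlim[OF f k0]
  proof eventually_elim
    case (elim h)
    have "Re (a * (h * A (z + h))) + Re (b * (h * A (z + h))\<^sup>2) =
       Re (a * \<alpha> * h) + Re ((a * \<beta> + b * \<alpha>\<^sup>2) * h\<^sup>2)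
         + Re ((a * Q h + b * ((A (z + h))\<^sup>2 - \<alpha>\<^sup>2)) * h\<^sup>2)"
      unfolding plus_complex.sel(1)[symmetric]
      unfolding A_eq by (rule arg_cong[where f=Re]) (simp add: algebra_simps power2_eq_square)
    also have "Re ((a * Q h + b * ((A (z + h))\<^sup>2 - \<alpha>\<^sup>2)) * h\<^sup>2) =
       (cmod h)\<^sup>2 * Re ((a * Q h + b * ((A (z + h))\<^sup>2 - \<alpha>\<^sup>2)) * u h)"
    proof -
      have "(a * Q h + b * ((A (z + h))\<^sup>2 - \<alpha>\<^sup>2)) * h\<^sup>2 =
        complex_of_real ((cmod h)\<^sup>2) * ((a * Q h + b * ((A (z + h))\<^sup>2 - \<alpha>\<^sup>2)) * u h)"
        by (subst u) simp
      then show ?thesis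
        by (simp only: Re_of_real_mult)
    qed
    finally have eq: "Re (a * (h * A (z + h))) + Re (b * (h * A (z + h))\<^sup>2) =
      Re (a * \<alpha> * h) + Re ((a * \<beta> + b * \<alpha>\<^sup>2) * h\<^sup>2) + (cmod h)\<^sup>2 * Re (T h)"
      by (simp only: T_def)
    show ?case
      unfolding \<phi> elim norm_mult power_mult_distrib F_def using eq[unfolded power_mult_distrib]
      by (simp add: algebra_simps del: times_complex.sel plus_complex.sel minus_complex.sel)
  qed
  ultimately show ?thesis
    unfolding has_laplacian_def \<alpha>_def by blast
qed

text \<open>Add the expansions at \<open>h = t, -t, \<i> t, -\<i> t\<close>. The linear terms cancel
  in pairs, the terms \<open>Re (b * h\<^sup>2)\<close> cancel between the two axes, and
  \<open>L * t\<^sup>2\<close> plus an error remains.\<close>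

lemma has_laplacian_nonneg_at_local_min:
  assumes f: "has_laplacian f L z" and min: "\<forall>\<^sub>F x in nhds z. f z \<le> f x"
  shows "L \<ge> 0"
proof -
  obtain a b E where E: "(E \<longlongrightarrow> 0) (nhds 0)"
    and f: "\<forall>\<^sub>F h in nhds 0. f (z + h) =
        f z + Re (a * h) + Re (b * h\<^sup>2) + L / 4 * (cmod h)\<^sup>2 + (cmod h)\<^sup>2 * E h"
    using assms(1) unfolding has_laplacian_def by blast
  have ev: "\<forall>\<^sub>F h in nhds 0. 0 \<le> Re (a * h) + Re (b * h\<^sup>2) + (cmod h)\<^sup>2 * (L / 4 + E h)"
    using f eventually_nhds_shift[OF min] by eventually_elim (simp add: algebra_simps)
  have lim: "filterlim (\<lambda>t. c * complex_of_real t) (nhds 0) (at_right 0)" for c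
    by (auto intro!: tendsto_eq_intros)
  have "((\<lambda>t. L + E (1 * of_real t) + E (- 1 * of_real t)
       + E (\<i> * of_real t) + E (- \<i> * of_real t)) \<longlongrightarrow> L + 0 + 0 + 0 + 0) (at_right 0)"
    by (intro tendsto_add tendsto_const filterlim_compose[OF E lim])
  moreover have "\<forall>\<^sub>F t in at_right 0. 0 \<le> L + E (1 * of_real t) + E (- 1 * of_real t)
       + E (\<i> * of_real t) + E (- \<i> * of_real t)"
    using eventually_compose_filterlim[OF ev lim[of 1]] eventually_compose_filterlim[OF ev lim[of "-1"]]
      eventually_compose_filterlim[OF ev lim[of \<i>]] eventually_compose_filterlim[OF ev lim[of "-\<i>"]]
      eventually_at_right_less[of 0]
  proof eventually_elim
    case (elim t)
    have "0 \<le> t\<^sup>2 * (L + E (1 * of_real t) + E (- 1 * of_real t)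
       + E (\<i> * of_real t) + E (- \<i> * of_real t))"
      using elim(1-4) by (simp add: norm_mult power_mult_distrib algebra_simps)
    with elim(5) show ?case
      by (simp add: zero_le_mult_iff)
  qed
  ultimately show ?thesis
    using tendsto_lowerbound[of _ L "at_right (0::real)" 0] by simp
qed

lemma has_laplacian_imp_DERIV:
  assumes "has_laplacian f L (complex_of_real \<rho>)"
  shows "\<exists>a. ((\<lambda>t. f (of_real t)) has_real_derivative Re a) (at \<rho>)"
proof -
  obtain a b E where E: "(E \<longlongrightarrow> 0) (nhds 0)"
    and f: "\<forall>\<^sub>F h in nhds 0. f (of_real \<rho> + h) =
        f (of_real \<rho>) + Re (a * h) + Re (b * h\<^sup>2) + L / 4 * (cmod h)\<^sup>2 + (cmod h)\<^sup>2 * E h"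
    using assms unfolding has_laplacian_def by blast
  have lim: "filterlim complex_of_real (nhds 0) (at 0)"
    by (auto intro!: tendsto_eq_intros)
  have E': "((\<lambda>t. E (complex_of_real t)) \<longlongrightarrow> 0) (at 0)"
    by (rule filterlim_compose[OF E lim])
  have "((\<lambda>t. Re a + t * (Re b + L / 4 + E (of_real t))) \<longlongrightarrow> Re a + 0 * (Re b + L / 4 + 0)) (at 0)"
    by (intro tendsto_intros E')
  moreover have "\<forall>\<^sub>F t in at 0. Re a + t * (Re b + L / 4 + E (of_real t)) =
      (f (of_real (\<rho> + t)) - f (of_real \<rho>)) / t"
    using eventually_compose_filterlim[OF f lim] eventually_neq_at_within[of 0]
    by eventually_elim (simp add: field_simps power2_eq_square)
  ultimately have "((\<lambda>t. (f (of_real (\<rho> + t)) - f (of_real \<rho>)) / t) \<longlongrightarrow> Re a) (at 0)"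
    by (simp add: tendsto_cong)
  then show ?thesis
    unfolding DERIV_def by blast
qed

subsection \<open>Laplacians of twice continuously differentiable functions\<close>

lemma has_laplacianI:
  assumes "\<And>e. e > 0 \<Longrightarrow> \<forall>\<^sub>F h in nhds 0.
     \<bar>f (z + h) - f z - (Re (a * h) + Re (b * h\<^sup>2) + L / 4 * (cmod h)\<^sup>2)\<bar> \<le> e * (cmod h)\<^sup>2"
  shows "has_laplacian f L z"
proof -
  define R where "R = (\<lambda>h. f (z + h) - f z - (Re (a * h) + Re (b * h\<^sup>2) + L / 4 * (cmod h)\<^sup>2))"
  \<comment> \<open>Division by zero gives \<open>E 0 = 0\<close>, as the limit along
    \<open>nhds 0\<close> (rather than \<open>at 0\<close>) requires.\<close>
  define E where "E = (\<lambda>h. R h / (cmod h)\<^sup>2)"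
  have "(E \<longlongrightarrow> 0) (nhds 0)"
  proof (rule tendstoI)
    fix e :: real assume "e > 0"
    then have "\<forall>\<^sub>F h in nhds 0. \<bar>R h\<bar> \<le> e / 2 * (cmod h)\<^sup>2"
      using assms[of "e / 2"] unfolding R_def by simp
    then show "\<forall>\<^sub>F h in nhds 0. dist (E h) 0 < e"
    proof eventually_elim
      case (elim h)
      show ?case
      proof (cases "h = 0")
        case False
        then have "\<bar>E h\<bar> \<le> e / 2"
          using elim by (simp add: E_def divide_simps)
        then show ?thesis
          using \<open>e > 0\<close> by simp
      qed (simp add: E_def \<open>e > 0\<close>)
    qed
  qed
  moreover have "f (z + h) =
      f z + Re (a * h) + Re (b * h\<^sup>2) + L / 4 * (cmod h)\<^sup>2 + (cmod h)\<^sup>2 * E h" for h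
    by (cases "h = 0") (simp_all add: E_def R_def)
  ultimately show ?thesis
    unfolding has_laplacian_def
    by (intro exI[of _ a] exI[of _ b] exI[of _ E] conjI always_eventually allI)
qed

lemma Taylor_second_order:
  fixes g g' g'' :: "real \<Rightarrow> real"
  assumes "\<And>u. \<bar>u - x\<bar> < d \<Longrightarrow> (g has_real_derivative g' u) (at u)"
    and "\<And>u. \<bar>u - x\<bar> < d \<Longrightarrow> (g' has_real_derivative g'' u) (at u)"
    and s: "\<bar>s\<bar> < d"
  shows "\<exists>\<xi>. \<bar>\<xi> - x\<bar> < d \<and> g (x + s) = g x + g' x * s + g'' \<xi> / 2 * s\<^sup>2"
proof (cases "s = 0")
  case True
  then show ?thesis
    using s by (intro exI[of _ x]) auto
next
  case False
  define diff where "diff = (\<lambda>m::nat. if m = 0 then g else if m = 1 then g' else g'')"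
  have "\<exists>t. (if x + s < x then x + s < t \<and> t < x else x < t \<and> t < x + s) \<and>
     g (x + s) = (\<Sum>m<2. (diff m x / fact m) * (x + s - x)^m) + (diff 2 t / fact 2) * (x + s - x)^2"
    using assms False
    by (intro Taylor[of 2 diff g "x - \<bar>s\<bar>" "x + \<bar>s\<bar>"]) (auto simp: diff_def less_2_cases_iff)
  then obtain t where t: "if x + s < x then x + s < t \<and> t < x else x < t \<and> t < x + s"
    and eq: "g (x + s) = g x + g' x * s + g'' t / 2 * s\<^sup>2"
    by (auto simp: diff_def numeral_2_eq_2)
  have "\<bar>t - x\<bar> < d"
    using t s by (auto split: if_splits)
  with eq show ?thesis
    by blast
qed

lemma increment_mean_value:
  fixes g g' :: "real \<Rightarrow> real"
  assumes "\<And>u. \<bar>u - x\<bar> < d \<Longrightarrow> (g has_real_derivative g' u) (at u)" and s: "\<bar>s\<bar> < d"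
  shows "\<exists>\<xi>. \<bar>\<xi> - x\<bar> < d \<and> g (x + s) = g x + g' \<xi> * s"
proof (cases "s = 0")
  case True
  then show ?thesis
    using s by (intro exI[of _ x]) auto
next
  case False
  define diff where "diff = (\<lambda>m::nat. if m = 0 then g else g')"
  have "\<exists>t. (if x + s < x then x + s < t \<and> t < x else x < t \<and> t < x + s) \<and>
     g (x + s) = (\<Sum>m<1. (diff m x / fact m) * (x + s - x)^m) + (diff 1 t / fact 1) * (x + s - x)^1"
    using assms False
    by (intro Taylor[of 1 diff g "x - \<bar>s\<bar>" "x + \<bar>s\<bar>"]) (auto simp: diff_def)
  then obtain t where t: "if x + s < x then x + s < t \<and> t < x else x < t \<and> t < x + s"
    and eq: "g (x + s) = g x + g' t * s"
    by (auto simp: diff_def)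
  have "\<bar>t - x\<bar> < d"
    using t s by (auto split: if_splits)
  with eq show ?thesis
    by blast
qed

text \<open>The increment is taken along a corner path: to second order in the first variable at
  height \<open>y + t\<close>, then everything on that line is carried back to height
  \<open>y\<close>. Only one of the two mixed derivatives arises this way.\<close>

lemma Taylor_second_order_partials:
  fixes F F1 F2 F11 F21 F22 :: "real \<Rightarrow> real \<Rightarrow> real"
  assumes D1: "\<And>s t. \<bar>s - x\<bar> < d \<Longrightarrow> \<bar>t - y\<bar> < d \<Longrightarrow> ((\<lambda>s. F s t) has_real_derivative F1 s t) (at s)"
    and D11: "\<And>s t. \<bar>s - x\<bar> < d \<Longrightarrow> \<bar>t - y\<bar> < d \<Longrightarrow> ((\<lambda>s. F1 s t) has_real_derivative F11 s t) (at s)"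
    and D21: "\<And>s t. \<bar>s - x\<bar> < d \<Longrightarrow> \<bar>t - y\<bar> < d \<Longrightarrow> (F1 s has_real_derivative F21 s t) (at t)"
    and D2: "\<And>s t. \<bar>s - x\<bar> < d \<Longrightarrow> \<bar>t - y\<bar> < d \<Longrightarrow> (F s has_real_derivative F2 s t) (at t)"
    and D22: "\<And>s t. \<bar>s - x\<bar> < d \<Longrightarrow> \<bar>t - y\<bar> < d \<Longrightarrow> (F2 s has_real_derivative F22 s t) (at t)"
    and B11: "\<And>s t. \<bar>s - x\<bar> < d \<Longrightarrow> \<bar>t - y\<bar> < d \<Longrightarrow> \<bar>F11 s t - F11 x y\<bar> \<le> e"
    and B21: "\<And>s t. \<bar>s - x\<bar> < d \<Longrightarrow> \<bar>t - y\<bar> < d \<Longrightarrow> \<bar>F21 s t - F21 x y\<bar> \<le> e"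
    and B22: "\<And>s t. \<bar>s - x\<bar> < d \<Longrightarrow> \<bar>t - y\<bar> < d \<Longrightarrow> \<bar>F22 s t - F22 x y\<bar> \<le> e"
    and s: "\<bar>s\<bar> < d" and t: "\<bar>t\<bar> < d"
  shows "\<bar>F (x + s) (y + t) - F x y - (F1 x y * s + F2 x y * t
           + F11 x y / 2 * s\<^sup>2 + F21 x y * (s * t) + F22 x y / 2 * t\<^sup>2)\<bar> \<le> e * (s\<^sup>2 + t\<^sup>2)"
proof -
  have d: "d > 0"
    using s by linarith
  obtain \<xi> where \<xi>: "\<bar>\<xi> - x\<bar> < d"
    "F (x + s) (y + t) = F x (y + t) + F1 x (y + t) * s + F11 \<xi> (y + t) / 2 * s\<^sup>2"
    using Taylor_second_order[of x d "\<lambda>s. F s (y + t)" "\<lambda>s. F1 s (y + t)" "\<lambda>s. F11 s (y + t)" s]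
      D1 D11 s t by auto
  obtain \<eta> where \<eta>: "\<bar>\<eta> - y\<bar> < d" "F1 x (y + t) = F1 x y + F21 x \<eta> * t"
    using increment_mean_value[of y d "F1 x" "F21 x" t] D21 d t by auto
  obtain \<zeta> where \<zeta>: "\<bar>\<zeta> - y\<bar> < d" "F x (y + t) = F x y + F2 x y * t + F22 x \<zeta> / 2 * t\<^sup>2"
    using Taylor_second_order[of y d "F x" "F2 x" "F22 x" t] D2 D22 d t by auto
  have e: "e \<ge> 0"
    using B11[of x y] d by auto
  define p q r where "p = F11 \<xi> (y + t) - F11 x y" and "q = F21 x \<eta> - F21 x y"
    and "r = F22 x \<zeta> - F22 x y"
  have pqr: "\<bar>p\<bar> \<le> e" "\<bar>q\<bar> \<le> e" "\<bar>r\<bar> \<le> e"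
    unfolding p_def q_def r_def using B11 B21 B22 \<xi> \<eta> \<zeta> d t by auto
  have "F (x + s) (y + t) - F x y - (F1 x y * s + F2 x y * t
           + F11 x y / 2 * s\<^sup>2 + F21 x y * (s * t) + F22 x y / 2 * t\<^sup>2)
      = p * (s\<^sup>2 / 2) + q * (s * t) + r * (t\<^sup>2 / 2)"
    unfolding p_def q_def r_def \<xi>(2) \<eta>(2) \<zeta>(2) by (simp add: field_simps)
  also have "\<bar>\<dots>\<bar> \<le> \<bar>p\<bar> * (s\<^sup>2 / 2) + \<bar>q\<bar> * \<bar>s * t\<bar> + \<bar>r\<bar> * (t\<^sup>2 / 2)"
    by (rule order_trans[OF abs_triangle_ineq] order_trans[OF add_mono[OF abs_triangle_ineq order_refl]])+
       (simp add: abs_mult)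
  also have "\<dots> \<le> e * (s\<^sup>2 / 2) + e * \<bar>s * t\<bar> + e * (t\<^sup>2 / 2)"
    using pqr by (intro add_mono mult_right_mono) auto
  also have "\<dots> = e * (s\<^sup>2 / 2 + \<bar>s * t\<bar> + t\<^sup>2 / 2)"
    by (simp add: algebra_simps)
  also have "\<dots> \<le> e * (s\<^sup>2 + t\<^sup>2)"
  proof (rule mult_left_mono[OF _ e])
    have "0 \<le> (\<bar>s\<bar> - \<bar>t\<bar>)\<^sup>2"
      by simp
    then show "s\<^sup>2 / 2 + \<bar>s * t\<bar> + t\<^sup>2 / 2 \<le> s\<^sup>2 + t\<^sup>2"
      by (simp add: power2_diff abs_mult)
  qed
  finally show ?thesis .
qed

definition vec_of_complex :: "complex \<Rightarrow> real ^ 2" where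
  "vec_of_complex z = vector [Re z, Im z]"

lemma norm_vec_of_complex [simp]: "norm (vec_of_complex z) = cmod z"
  by (simp add: vec_of_complex_def norm_vec_def L2_set_def sum_2 cmod_def)

lemma vec_of_complex_eq_0_iff [simp]: "vec_of_complex z = 0 \<longleftrightarrow> z = 0"
  by (metis norm_eq_zero norm_vec_of_complex)

lemma DERIV_pderiv_at_1:
  assumes "(\<lambda>\<tau>. g (vector [s, t] + \<tau> *\<^sub>R axis 1 1)) differentiable (at 0)"
  shows "((\<lambda>s. g (vector [s, t] :: real ^ 2)) has_real_derivative pderiv_at 1 g (vector [s, t])) (at s)"
proof -
  have "(vector [s, t] :: real ^ 2) + \<tau> *\<^sub>R axis 1 1 = vector [\<tau> + s, t]" for \<tau>
    by (simp add: vec_eq_iff forall_2 axis_def)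
  then show ?thesis
    using assms DERIV_shift[of "\<lambda>s. g (vector [s, t])" "pderiv_at 1 g (vector [s, t])" 0 s]
    by (simp add: pderiv_at_def DERIV_deriv_iff_real_differentiable)
qed

lemma DERIV_pderiv_at_2:
  assumes "(\<lambda>\<tau>. g (vector [s, t] + \<tau> *\<^sub>R axis 2 1)) differentiable (at 0)"
  shows "((\<lambda>t. g (vector [s, t] :: real ^ 2)) has_real_derivative pderiv_at 2 g (vector [s, t])) (at t)"
proof -
  have "(vector [s, t] :: real ^ 2) + \<tau> *\<^sub>R axis 2 1 = vector [s, \<tau> + t]" for \<tau>
    by (simp add: vec_eq_iff forall_2 axis_def)
  then show ?thesis
    using assms DERIV_shift[of "\<lambda>t. g (vector [s, t])" "pderiv_at 2 g (vector [s, t])" 0 t]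
    by (simp add: pderiv_at_def DERIV_deriv_iff_real_differentiable)
qed

lemma has_laplacian_if_Ck_on_2:
  assumes g: "Ck_on 2 S g" and S: "open S" "vec_of_complex z \<in> S"
  shows "has_laplacian (\<lambda>z. g (vec_of_complex z)) (laplacian g (vec_of_complex z)) z"
proof -
  define x y where "x = Re z" and "y = Im z"
  define P where "P = (\<lambda>i j. pderiv_at i (pderiv_at j g))"
  have diff: "(\<lambda>\<tau>. g (v + \<tau> *\<^sub>R axis j 1)) differentiable (at 0)"
       "(\<lambda>\<tau>. pderiv_at j g (v + \<tau> *\<^sub>R axis i 1)) differentiable (at 0)"
    if "v \<in> S" for v i j
    using g that by (auto simp: numeral_2_eq_2)
  have cont: "continuous_on S (P i j)" for i j
    using g by (auto simp: numeral_2_eq_2 P_def)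
  have xy: "vector [x, y] \<in> S"
    using S by (simp add: x_def y_def vec_of_complex_def)
  have near: "\<exists>d>0. \<forall>s t. \<bar>s - x\<bar> < d \<longrightarrow> \<bar>t - y\<bar> < d \<longrightarrow> vector [s, t] \<in> S \<and>
      (\<forall>i j. \<bar>P i j (vector [s, t]) - P i j (vector [x, y])\<bar> \<le> e)" if "e > 0" for e :: real
  proof -
    have "\<forall>\<^sub>F v in nhds (vector [x, y]). \<bar>P i j v - P i j (vector [x, y])\<bar> < e" for i j
    proof -
      have "isCont (P i j) (vector [x, y])"
        using cont S xy continuous_on_eq_continuous_at by blast
      then have "(P i j \<longlongrightarrow> P i j (vector [x, y])) (nhds (vector [x, y]))"
        by (simp add: isCont_def tendsto_nhds_iff)
      then show ?thesis
        using tendstoD[OF _ \<open>e > 0\<close>] by (fastforce simp: dist_real_def)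
    qed
    then have "\<forall>\<^sub>F v in nhds (vector [x, y]). v \<in> S \<and>
        (\<forall>i j. \<bar>P i j v - P i j (vector [x, y])\<bar> < e)"
      using S(1) xy by (intro eventually_conj eventually_nhds_in_open eventually_all_finite) auto
    then obtain d where d: "d > 0"
      and D: "\<And>v. dist v (vector [x, y]) < d \<Longrightarrow> v \<in> S \<and>
        (\<forall>i j. \<bar>P i j v - P i j (vector [x, y])\<bar> < e)"
      unfolding eventually_nhds_metric by blast
    have "dist (vector [s, t]) (vector [x, y] :: real ^ 2) < d"
      if "\<bar>s - x\<bar> < d / 2" "\<bar>t - y\<bar> < d / 2" for s t
    proof -
      have "dist (vector [s, t]) (vector [x, y] :: real ^ 2) \<le> \<bar>s - x\<bar> + \<bar>t - y\<bar>"
        using norm_le_l1_cart[of "vector [s, t] - (vector [x, y] :: real ^ 2)"]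
        by (simp add: dist_norm sum_2)
      with that show ?thesis
        by simp
    qed
    with D d show ?thesis
      by (intro exI[of _ "d / 2"]) (auto intro: less_imp_le)
  qed
  \<comment> \<open>Obtained by matching coefficients with \<open>h = s + \<i> t\<close>:
    \<open>Re (b * h\<^sup>2)\<close> carries the trace-free part of the Hessian and
    \<open>L / 4 * (cmod h)\<^sup>2\<close> the trace. The minus signs come from
    \<open>Re (a * h) = Re a * s - Im a * t\<close>.\<close>
  define a b L where "a = Complex (pderiv_at 1 g (vector [x, y])) (- pderiv_at 2 g (vector [x, y]))"
    and "b = Complex ((P 1 1 (vector [x, y]) - P 2 2 (vector [x, y])) / 4) (- P 2 1 (vector [x, y]) / 2)"
    and "L = P 1 1 (vector [x, y]) + P 2 2 (vector [x, y])"
  have "has_laplacian (\<lambda>z. g (vec_of_complex z)) L z"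
  proof (rule has_laplacianI)
    fix e :: real assume "e > 0"
    then obtain d where d: "d > 0"
      and D: "\<And>s t. \<bar>s - x\<bar> < d \<Longrightarrow> \<bar>t - y\<bar> < d \<Longrightarrow> vector [s, t] \<in> S"
        "\<And>s t i j. \<bar>s - x\<bar> < d \<Longrightarrow> \<bar>t - y\<bar> < d \<Longrightarrow> \<bar>P i j (vector [s, t]) - P i j (vector [x, y])\<bar> \<le> e"
      using near by meson
    have "\<forall>\<^sub>F h :: complex in nhds 0. cmod h < d"
      unfolding eventually_nhds_metric using d by auto
    then show "\<forall>\<^sub>F h in nhds 0. \<bar>g (vec_of_complex (z + h)) - g (vec_of_complex z)
       - (Re (a * h) + Re (b * h\<^sup>2) + L / 4 * (cmod h)\<^sup>2)\<bar> \<le> e * (cmod h)\<^sup>2"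
    proof eventually_elim
      case (elim h)
      define s t where "s = Re h" and "t = Im h"
      have st: "\<bar>s\<bar> < d" "\<bar>t\<bar> < d"
        using elim abs_Re_le_cmod[of h] abs_Im_le_cmod[of h] by (auto simp: s_def t_def)
      have "\<bar>g (vector [x + s, y + t]) - g (vector [x, y])
         - (pderiv_at 1 g (vector [x, y]) * s + pderiv_at 2 g (vector [x, y]) * t
           + P 1 1 (vector [x, y]) / 2 * s\<^sup>2 + P 2 1 (vector [x, y]) * (s * t)
           + P 2 2 (vector [x, y]) / 2 * t\<^sup>2)\<bar> \<le> e * (s\<^sup>2 + t\<^sup>2)"
        by (rule Taylor_second_order_partials[where d=d])
          (use st D diff in \<open>auto simp: P_def intro!: DERIV_pderiv_at_1 DERIV_pderiv_at_2\<close>)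
      moreover have "Re (a * h) + Re (b * h\<^sup>2) + L / 4 * (cmod h)\<^sup>2 =
          pderiv_at 1 g (vector [x, y]) * s + pderiv_at 2 g (vector [x, y]) * t
           + P 1 1 (vector [x, y]) / 2 * s\<^sup>2 + P 2 1 (vector [x, y]) * (s * t)
           + P 2 2 (vector [x, y]) / 2 * t\<^sup>2"
        unfolding cmod_power2
        by (simp add: a_def b_def L_def s_def t_def power2_eq_square field_simps)
      ultimately show ?case
        by (simp add: vec_of_complex_def x_def y_def s_def t_def cmod_power2)
    qed
  qed
  then show ?thesis
    by (simp add: laplacian_def sum_2 L_def P_def vec_of_complex_def x_def y_def)
qed

subsection \<open>The boundary point lemma\<close>

lemma has_laplacian_const: "has_laplacian (\<lambda>_. c) 0 z"
  using has_laplacian_quadratic[of c 0 0 0 z] by simp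

lemma has_laplacian_ln_cmod:
  assumes "z \<noteq> p"
  shows "has_laplacian (\<lambda>x. ln (cmod (x - p))) 0 z"
proof -
  define S where "S = ball z (cmod (z - p))"
  \<comment> \<open>Dividing by \<open>z - p\<close> moves the base point to \<open>1\<close>, so
    that the whole ball \<open>S\<close> lands in the right half-plane, away from the branch
    cut.\<close>
  define \<phi> where "\<phi> = (\<lambda>x. Ln ((x - p) / (z - p)))"
  have S: "open S" "z \<in> S"
    using assms by (auto simp: S_def)
  have pos: "Re ((x - p) / (z - p)) > 0" if "x \<in> S" for x
  proof -
    have "cmod ((x - z) / (z - p)) < 1"
      using that assms by (simp add: S_def norm_divide dist_norm norm_minus_commute)
    then have "\<bar>Re ((x - z) / (z - p))\<bar> < 1"
      using abs_Re_le_cmod by (rule le_less_trans[rotated])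
    moreover have "(x - p) / (z - p) = 1 + (x - z) / (z - p)"
      using assms by (simp add: field_simps)
    ultimately show ?thesis
      by simp
  qed
  have hol: "\<phi> holomorphic_on S"
    unfolding \<phi>_def using pos assms
    by (intro holomorphic_intros) (force simp: complex_nonpos_Reals_iff)+
  have "has_laplacian Re 0 (\<phi> z)"
    using has_laplacian_quadratic[of 0 1 0 0 "\<phi> z"] by simp
  from has_laplacian_compose_holomorphic[OF this hol S]
  have "has_laplacian (\<lambda>x. Re (\<phi> x)) 0 z"
    by simp
  from has_laplacian_add[OF this has_laplacian_const[of "ln (cmod (z - p))"]]
  have "has_laplacian (\<lambda>x. Re (\<phi> x) + ln (cmod (z - p))) 0 z"
    by simp
  then show ?thesis
  proof (rule has_laplacian_cong)
    show "\<forall>\<^sub>F x in nhds z. ln (cmod (x - p)) = Re (\<phi> x) + ln (cmod (z - p))"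
      using eventually_nhds_in_open[OF S]
    proof eventually_elim
      case (elim x)
      then have "x \<noteq> p"
        using pos[of x] by auto
      then show ?case
        using assms by (simp add: \<phi>_def norm_divide ln_div)
    qed
  qed
qed

text \<open>The even power is the squared modulus of the holomorphic function
  \<open>(1 / (x - c)) ^ j\<close>. Since \<open>(cmod x)\<^sup>2\<close> has Laplacian 4, conformal
  change of variables gives the formula.\<close>

lemma has_laplacian_inverse_power:
  assumes "z \<noteq> c" "j \<ge> 1"
  shows "has_laplacian (\<lambda>x. (1 / cmod (x - c)) ^ (2 * j))
     (4 * (real j)\<^sup>2 * (1 / cmod (z - c)) ^ (2 * j + 2)) z"
proof -
  define \<phi> where "\<phi> = (\<lambda>x. (1 / (x - c)) ^ j)"
  have "\<phi> holomorphic_on - {c}"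
    unfolding \<phi>_def by (intro holomorphic_intros) auto
  moreover have "open (- {c})" "z \<in> - {c}"
    using assms by auto
  moreover have "has_laplacian (\<lambda>x. (cmod x)\<^sup>2) 4 (\<phi> z)"
    using has_laplacian_quadratic[of 0 0 0 4 "\<phi> z"] by simp
  ultimately have *: "has_laplacian (\<lambda>x. (cmod (\<phi> x))\<^sup>2) ((cmod (deriv \<phi> z))\<^sup>2 * 4) z"
    by (intro has_laplacian_compose_holomorphic)
  have "(\<phi> has_field_derivative of_nat j * (1 / (z - c)) ^ (j - 1) * (- 1 / (z - c)\<^sup>2)) (at z)"
    unfolding \<phi>_def using assms
    by (auto intro!: derivative_eq_intros simp: power2_eq_square)
  then have "deriv \<phi> z = of_nat j * (1 / (z - c)) ^ (j - 1) * (- 1 / (z - c)\<^sup>2)"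
    by (rule DERIV_imp_deriv)
  then have "cmod (deriv \<phi> z) = real j * ((1 / cmod (z - c)) ^ (j - 1) * (1 / cmod (z - c))\<^sup>2)"
    by (simp add: norm_mult norm_divide norm_power power_divide)
  also have "\<dots> = real j * (1 / cmod (z - c)) ^ (j + 1)"
    using assms(2) by (simp flip: power_add)
  finally have norm_deriv: "cmod (deriv \<phi> z) = real j * (1 / cmod (z - c)) ^ (j + 1)" .
  have power_sq: "t ^ (2 * j + 2) = (t ^ (j + 1))\<^sup>2" for t :: real
    by (simp add: power2_eq_square mult_2 flip: power_add)
  have "(cmod (deriv \<phi> z))\<^sup>2 * 4 = 4 * (real j)\<^sup>2 * (1 / cmod (z - c)) ^ (2 * j + 2)"
    by (simp only: norm_deriv power_mult_distrib power_sq)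
  moreover have "(\<lambda>x. (cmod (\<phi> x))\<^sup>2) = (\<lambda>x. (1 / cmod (x - c)) ^ (2 * j))"
    by (simp add: \<phi>_def norm_power norm_divide mult.commute flip: power_mult)
  ultimately show ?thesis
    using * by simp
qed

text \<open>This is what makes the barrier grow at least linearly inwards from the outer circle. For
  \<open>k = 1\<close> it is direct, and because \<open>1 / R \<ge> 1\<close> the difference of
  powers only grows with \<open>k\<close>.\<close>

lemma inverse_power_diff_ge:
  assumes "0 < \<rho>" "\<rho> \<le> R" "R \<le> (1::real)" "k \<ge> 1"
  shows "R - \<rho> \<le> (1 / \<rho>) ^ k - (1 / R) ^ k"
proof -
  define a b where "a = 1 / \<rho>" and "b = 1 / R"
  have ab: "1 \<le> b" "b \<le> a"
    using assms by (auto simp: a_def b_def field_simps)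
  have "R - \<rho> \<le> (R - \<rho>) / (\<rho> * R)"
    using assms by (simp add: le_divide_eq mult_left_le mult_le_one)
  also have "\<dots> = a - b"
    using assms by (simp add: a_def b_def field_simps)
  also have "\<dots> \<le> a ^ k - b ^ k"
    using \<open>k \<ge> 1\<close>
  proof (induction k rule: dec_induct)
    case (step k)
    have "a ^ k - b ^ k \<le> b * (a ^ k - b ^ k)"
      using ab mult_right_mono[of 1 b "a ^ k - b ^ k"] by (simp add: power_mono)
    also have "\<dots> \<le> a * a ^ k - b * b ^ k"
      using ab by (simp add: right_diff_distrib mult_right_mono)
    finally show ?case
      using step by simp
  qed simp
  finally show ?thesis
    by (simp add: a_def b_def)
qed

text \<open>The logarithm makes the comparison insensitive to the single point \<open>p\<close>, at which nothing
  but continuity of \<open>w\<close> is required.\<close>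

lemma Hopf_barrier:
  fixes w :: "complex \<Rightarrow> real"
  assumes cont: "continuous_on (cball c R) w" and nonneg: "\<And>x. x \<in> cball c R \<Longrightarrow> w x \<ge> 0"
    and r: "0 < r" "r < R" "R \<le> 1" and pos: "\<And>x. x \<in> sphere c r \<Longrightarrow> w x > 0"
    and L: "L \<ge> 0"
    and super: "\<And>x. x \<in> ball c R \<Longrightarrow> x \<noteq> p \<Longrightarrow> \<exists>D. has_laplacian w D x \<and> D \<le> L * w x"
  shows "\<exists>\<kappa>>0. \<forall>x\<in>cball c R. r \<le> cmod (x - c) \<longrightarrow> \<kappa> * (R - cmod (x - c)) \<le> w x"
proof -
  \<comment> \<open>With radii at most \<open>1\<close>, the Laplacian of
    \<open>(1 / cmod (x - c)) ^ (2 * j)\<close> is at least \<open>4 * (real j)\<^sup>2\<close>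
    times the function itself. The choice of \<open>j\<close> makes this exceed the zero-order term
    with constant \<open>L\<close>.\<close>
  obtain j where j: "j \<ge> 1" "L < 4 * (real j)\<^sup>2"
  proof -
    obtain N :: nat where N: "L < real N"
      using reals_Archimedean2 by blast
    have "real (Suc N) \<le> 4 * (real (Suc N))\<^sup>2"
      by (simp add: power2_eq_square)
    with N show ?thesis
      by (intro that[of "Suc N"]) auto
  qed
  define s where "s = (\<lambda>x. (1 / cmod (x - c)) ^ (2 * j) - (1 / R) ^ (2 * j))"
  have s_le: "s x \<le> (1 / cmod (x - c)) ^ (2 * j)" for x
    using r by (simp add: s_def)
  have sphere_ne: "c + of_real r \<in> sphere c r"
    using r by (simp add: dist_norm)
  have "continuous_on (sphere c r) w"
    using cont by (rule continuous_on_subset) (use r in auto)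
  then have "\<exists>x\<in>sphere c r. \<forall>y\<in>sphere c r. w x \<le> w y"
    using sphere_ne r by (intro continuous_attains_inf) auto
  then obtain x0 where x0: "x0 \<in> sphere c r" "\<And>x. x \<in> sphere c r \<Longrightarrow> w x0 \<le> w x"
    by blast
  define smax where "smax = (1 / r) ^ (2 * j) - (1 / R) ^ (2 * j)"
  have smax: "smax > 0"
    using inverse_power_diff_ge[of r R "2 * j"] r j by (simp add: smax_def)
  define \<kappa> where "\<kappa> = w x0 / smax"
  have \<kappa>: "\<kappa> > 0"
    using pos[OF x0(1)] smax by (simp add: \<kappa>_def)
  have inner: "\<kappa> * s x \<le> w x" if "cmod (x - c) = r" for x
  proof -
    have "\<kappa> * s x = w x0"
      using that smax by (simp add: \<kappa>_def s_def smax_def)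
    then show ?thesis
      using x0(2)[of x] that by (simp add: dist_norm norm_minus_commute)
  qed
  have outer: "\<kappa> * s x \<le> w x" if "cmod (x - c) = R" for x
    using nonneg[of x] that by (simp add: s_def dist_norm norm_minus_commute)
  \<comment> \<open>Large enough that \<open>ln M - ln (cmod (x - p))\<close> is positive on the
    whole ball, so the logarithmic term only helps the comparison.\<close>
  define M where "M = R + cmod (c - p) + 1"
  have M: "cmod (x - p) < M" if "x \<in> cball c R" for x
  proof -
    have "cmod (x - p) \<le> cmod (x - c) + cmod (c - p)"
      using norm_triangle_ineq[of "x - c" "c - p"] by simp
    then show ?thesis
      using that by (simp add: M_def dist_norm norm_minus_commute)
  qed
  have "M > 0"
    using r by (simp add: M_def add_pos_nonneg)
  define A where "A = {x \<in> cball c R. r \<le> cmod (x - c)}"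
  have AD: "x \<in> cball c R" "r \<le> cmod (x - c)" "cmod (x - c) \<le> R" if "x \<in> A" for x
    using that by (auto simp: A_def dist_norm norm_minus_commute)
  define T where "T = \<kappa> * (1 / r) ^ (2 * j)"
  have s_le_T: "\<kappa> * s x \<le> T" if "x \<in> A" for x
  proof -
    have "s x \<le> (1 / r) ^ (2 * j)"
      using s_le[of x] by (rule order_trans)
        (use AD(2)[OF that] r in \<open>intro power_mono divide_left_mono mult_pos_pos, auto\<close>)
    then show ?thesis
      using \<kappa> by (simp add: T_def)
  qed
  have T: "T > 0"
    using \<kappa> r by (simp add: T_def)
  have key: "0 \<le> w x - \<kappa> * s x + \<epsilon> * (ln M - ln (cmod (x - p)))"
    if "x \<in> A" "x \<noteq> p" "\<epsilon> > 0" for x \<epsilon>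
  proof (rule ccontr)
    define q where "q = (\<lambda>x. w x - \<kappa> * s x + \<epsilon> * (ln M - ln (cmod (x - p))))"
    assume "\<not> 0 \<le> w x - \<kappa> * s x + \<epsilon> * (ln M - ln (cmod (x - p)))"
    then have qx: "q x < 0"
      by (simp add: q_def)
    \<comment> \<open>At distance at most \<open>\<eta>\<close> from \<open>p\<close> the
      logarithmic term alone reaches \<open>T\<close>, an upper bound of
      \<open>\<kappa> * s\<close>. A negative minimum of \<open>q\<close> is therefore attained
      farther from \<open>p\<close>, where the inequality for \<open>w\<close> is available.\<close>
    define \<eta> where "\<eta> = M * exp (- T / \<epsilon>)"
    have \<eta>: "\<eta> > 0"
      using \<open>M > 0\<close> by (simp add: \<eta>_def)
    have q_nonneg: "0 \<le> q y" if y: "y \<in> A" "y \<noteq> p" "cmod (y - p) \<le> \<eta> \<or> \<kappa> * s y \<le> w y" for y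
    proof -
      have "0 \<le> ln M - ln (cmod (y - p))"
        using M[OF AD(1)[OF y(1)]] y(2) \<open>M > 0\<close> by simp
      moreover have "T \<le> \<epsilon> * (ln M - ln (cmod (y - p)))" if "cmod (y - p) \<le> \<eta>"
      proof -
        have "ln (cmod (y - p)) \<le> ln \<eta>"
          using that y \<eta> by simp
        also have "\<dots> = ln M - T / \<epsilon>"
          using \<open>M > 0\<close> by (simp add: \<eta>_def ln_mult)
        finally show ?thesis
          using \<open>\<epsilon> > 0\<close> by (simp add: field_simps)
      qed
      ultimately show ?thesis
        using y(3) s_le_T[OF y(1)] nonneg[OF AD(1)[OF y(1)]] \<open>\<epsilon> > 0\<close>
        by (auto simp: q_def intro: add_nonneg_nonneg)
    qed
    define K where "K = A \<inter> {y. \<eta> \<le> cmod (y - p)}"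
    have "K = cball c R \<inter> ({x. r \<le> cmod (x - c)} \<inter> {y. \<eta> \<le> cmod (y - p)})"
      by (auto simp: K_def A_def)
    moreover have "closed ({x. r \<le> cmod (x - c)} \<inter> {y. \<eta> \<le> cmod (y - p)})"
      by (intro closed_Int closed_Collect_le continuous_intros)
    ultimately have "compact K"
      by (simp add: compact_Int_closed)
    have "continuous_on K q"
      unfolding q_def s_def
    proof (intro continuous_intros)
      show "continuous_on K w"
        using cont by (rule continuous_on_subset) (auto simp: K_def A_def)
    qed (use \<eta> r in \<open>auto simp: K_def A_def\<close>)
    moreover have "x \<in> K"
      using q_nonneg[of x] qx that(1,2) by (force simp: K_def)
    ultimately obtain y where y: "y \<in> K" "\<And>x. x \<in> K \<Longrightarrow> q y \<le> q x"
      using continuous_attains_inf[of K q] \<open>compact K\<close> by blast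
    have qy: "q y < 0"
      using y(2)[OF \<open>x \<in> K\<close>] qx by simp
    have yA: "y \<in> A" "y \<noteq> p"
      using y(1) \<eta> by (auto simp: K_def)
    then have *: "\<not> (cmod (y - p) \<le> \<eta> \<or> \<kappa> * s y \<le> w y)"
      using q_nonneg[of y] qy by auto
    define \<rho> where "\<rho> = cmod (y - c)"
    have \<rho>: "r < \<rho>" "\<rho> < R"
      using * inner[of y] outer[of y] AD[OF yA(1)] by (auto simp: \<rho>_def less_le)
    have "open ({x. r < cmod (x - c)} \<inter> {x. cmod (x - c) < R} \<inter> {x. \<eta> < cmod (x - p)})"
      by (intro open_Int open_Collect_less continuous_intros)
    then have "\<forall>\<^sub>F x in nhds y. x \<in> {x. r < cmod (x - c)} \<inter> {x. cmod (x - c) < R} \<inter> {x. \<eta> < cmod (x - p)}"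
      by (rule eventually_nhds_in_open) (use \<rho> * in \<open>auto simp: \<rho>_def\<close>)
    then have ev: "\<forall>\<^sub>F x in nhds y. q y \<le> q x"
      by eventually_elim (auto intro!: y(2) simp: K_def A_def dist_norm norm_minus_commute)
    have "y \<in> ball c R"
      using \<rho> by (simp add: \<rho>_def dist_norm norm_minus_commute)
    then obtain D where D: "has_laplacian w D y" "D \<le> L * w y"
      using super yA(2) by blast
    have "y \<noteq> c"
      using \<rho> r by (auto simp: \<rho>_def)
    have "has_laplacian (\<lambda>x. w x + (- \<kappa>) * ((1 / cmod (x - c)) ^ (2 * j))
        + ((\<kappa> * (1 / R) ^ (2 * j) + \<epsilon> * ln M) + (- \<epsilon>) * ln (cmod (x - p))))
       (D + (- \<kappa>) * (4 * (real j)\<^sup>2 * (1 / cmod (y - c)) ^ (2 * j + 2)) + (0 + (- \<epsilon>) * 0)) y"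
      using \<open>y \<noteq> c\<close> yA(2) j(1)
      by (intro has_laplacian_add has_laplacian_cmult has_laplacian_const D(1)
          has_laplacian_inverse_power has_laplacian_ln_cmod)
    moreover have "(\<lambda>x. w x + (- \<kappa>) * ((1 / cmod (x - c)) ^ (2 * j))
        + ((\<kappa> * (1 / R) ^ (2 * j) + \<epsilon> * ln M) + (- \<epsilon>) * ln (cmod (x - p)))) = q"
      by (simp add: q_def s_def fun_eq_iff algebra_simps)
    ultimately have "has_laplacian q
       (D + (- \<kappa>) * (4 * (real j)\<^sup>2 * (1 / cmod (y - c)) ^ (2 * j + 2)) + (0 + (- \<epsilon>) * 0)) y"
      by (simp only:)
    from has_laplacian_nonneg_at_local_min[OF this ev]
    have "0 \<le> D - \<kappa> * (4 * (real j)\<^sup>2 * (1 / \<rho>) ^ (2 * j + 2))"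
      by (simp add: \<rho>_def)
    also have "\<dots> \<le> L * (\<kappa> * (1 / \<rho>) ^ (2 * j)) - \<kappa> * (4 * (real j)\<^sup>2 * (1 / \<rho>) ^ (2 * j))"
    proof -
      have "w y \<le> \<kappa> * s y"
        using * by simp
      also have "\<dots> \<le> \<kappa> * (1 / \<rho>) ^ (2 * j)"
        using s_le[of y] \<kappa> by (simp add: \<rho>_def)
      finally have "D \<le> L * (\<kappa> * (1 / \<rho>) ^ (2 * j))"
        using D(2) L by (meson mult_left_mono order_trans)
      moreover have "(1 / \<rho>) ^ (2 * j) \<le> (1 / \<rho>) ^ (2 * j + 2)"
        using \<rho> r by (intro power_increasing) auto
      then have "\<kappa> * (4 * (real j)\<^sup>2 * (1 / \<rho>) ^ (2 * j)) \<le> \<kappa> * (4 * (real j)\<^sup>2 * (1 / \<rho>) ^ (2 * j + 2))"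
        using \<kappa> by (intro mult_left_mono) auto
      ultimately show ?thesis
        by linarith
    qed
    also have "\<dots> = (L - 4 * (real j)\<^sup>2) * (\<kappa> * (1 / \<rho>) ^ (2 * j))"
      by (simp add: algebra_simps)
    also have "\<dots> < 0"
      using j(2) \<kappa> \<rho> r by (intro mult_neg_pos) auto
    finally show False
      by simp
  qed
  have off_p: "\<kappa> * s x \<le> w x" if x: "x \<in> A" "x \<noteq> p" for x
  proof -
    have "((\<lambda>\<epsilon>. w x - \<kappa> * s x + \<epsilon> * (ln M - ln (cmod (x - p)))) \<longlongrightarrow>
        w x - \<kappa> * s x + 0 * (ln M - ln (cmod (x - p)))) (at_right 0)"
      by (intro tendsto_intros)
    moreover have "\<forall>\<^sub>F \<epsilon> in at_right 0. 0 \<le> w x - \<kappa> * s x + \<epsilon> * (ln M - ln (cmod (x - p)))"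
      using eventually_at_right_less[of 0] by eventually_elim (use key x in auto)
    ultimately have "0 \<le> w x - \<kappa> * s x + 0 * (ln M - ln (cmod (x - p)))"
      by (intro tendsto_lowerbound) auto
    then show ?thesis
      by simp
  qed
  have "\<kappa> * s x \<le> w x" if x: "x \<in> A" for x
  proof (cases "x \<noteq> p \<or> cmod (x - c) = r \<or> cmod (x - c) = R")
    case True
    then show ?thesis
      using off_p x inner outer by blast
  next
    case False
    then have px: "p = x" "r < cmod (x - c)" "cmod (x - c) < R"
      using AD[OF x] by auto
    \<comment> \<open>What remains is \<open>x = p\<close> strictly inside the annulus, where the
      estimate passes from the punctured neighbourhood to the point by continuity.\<close>
    define Ann where "Ann = {x. r < cmod (x - c)} \<inter> {x. cmod (x - c) < R}"
    have "open Ann"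
      unfolding Ann_def by (intro open_Int open_Collect_less continuous_intros)
    have "Ann \<subseteq> A"
      by (auto simp: Ann_def A_def dist_norm norm_minus_commute)
    have "x \<in> Ann"
      using px by (simp add: Ann_def)
    have "continuous_on Ann (\<lambda>x. w x - \<kappa> * s x)"
      unfolding s_def
    proof (intro continuous_intros)
      show "continuous_on Ann w"
        using cont by (rule continuous_on_subset) (auto simp: Ann_def dist_norm norm_minus_commute)
    qed (use r in \<open>auto simp: Ann_def\<close>)
    then have "((\<lambda>x. w x - \<kappa> * s x) \<longlongrightarrow> w x - \<kappa> * s x) (at x)"
      using \<open>open Ann\<close> \<open>x \<in> Ann\<close> continuous_on_eq_continuous_at isCont_def by blast
    moreover have "\<forall>\<^sub>F y in at x. 0 \<le> w y - \<kappa> * s y"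
      using eventually_at_in_open[OF \<open>open Ann\<close> \<open>x \<in> Ann\<close>]
      by eventually_elim (use off_p \<open>Ann \<subseteq> A\<close> px in auto)
    ultimately have "0 \<le> w x - \<kappa> * s x"
      by (intro tendsto_lowerbound) auto
    then show ?thesis
      by simp
  qed
  moreover have "\<kappa> * (R - cmod (x - c)) \<le> \<kappa> * s x" if "x \<in> A" for x
    using inverse_power_diff_ge[of "cmod (x - c)" R "2 * j"] AD[OF that] r j \<kappa>
    by (fastforce simp: s_def)
  ultimately have "\<kappa> * (R - cmod (x - c)) \<le> w x" if "x \<in> A" for x
    using that order_trans by blast
  with \<kappa> show ?thesis
    by (auto simp: A_def)
qed

subsection \<open>Moving planes\<close>

text \<open>The Lipschitz assumption is one-sided off the diagonal: by cooperativity, a component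
  \<open>j\<close> other than \<open>i\<close> can lower \<open>g i\<close> only when it decreases.
  The bound is uniform for values down to \<open>0\<close>, hence up to the boundary of the disc. A
  locale allows the same results to be reused for rotated solutions.\<close>

locale cooperative_system_on_disc =
  fixes V :: "'m::finite \<Rightarrow> complex \<Rightarrow> real" and g :: "'m \<Rightarrow> real \<Rightarrow> real ^ 'm \<Rightarrow> real"
  assumes V_cont: "continuous_on (cball 0 1) (V i)"
    and V_bdry: "cmod x = 1 \<Longrightarrow> V i x = 0"
    and V_pos: "cmod x < 1 \<Longrightarrow> V i x > 0"
    and V_eq: "cmod x < 1 \<Longrightarrow> x \<noteq> 0 \<Longrightarrow> has_laplacian (V i) (- g i (cmod x) (\<chi> j. V j x)) x"
    and g_mono: "v \<in> pos_orthant \<Longrightarrow> 0 < r \<Longrightarrow> r \<le> s \<Longrightarrow> s < 1 \<Longrightarrow> g i s v \<le> g i r v"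
    and g_lip: "0 < r0 \<Longrightarrow> r0 < 1 \<Longrightarrow> 0 < M \<Longrightarrow>
      \<exists>L\<ge>0. \<forall>i r a b. r0 < r \<longrightarrow> r < 1 \<longrightarrow> (\<forall>k. a $ k \<in> {0<..M}) \<longrightarrow> (\<forall>k. b $ k \<in> {0<..M}) \<longrightarrow>
        g i r a - g i r b \<ge> - L * (\<bar>a $ i - b $ i\<bar> + (\<Sum>j\<in>UNIV. max 0 (b $ j - a $ j)))"
begin

definition reflect :: "real \<Rightarrow> complex \<Rightarrow> complex" where
  "reflect \<tau> x = 2 * of_real \<tau> - cnj x"

definition w :: "real \<Rightarrow> 'm \<Rightarrow> complex \<Rightarrow> real" where
  "w \<tau> i x = V i (reflect \<tau> x) - V i x"

lemma cmod_reflect: "(cmod (reflect \<tau> x))\<^sup>2 = (cmod x)\<^sup>2 - 4 * \<tau> * (Re x - \<tau>)"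
  unfolding cmod_power2 by (simp add: reflect_def power2_eq_square algebra_simps)

lemma cmod_reflect_le: "0 \<le> \<tau> \<Longrightarrow> \<tau> \<le> Re x \<Longrightarrow> cmod (reflect \<tau> x) \<le> cmod x"
  by (rule power2_le_imp_le[OF _ norm_ge_zero]) (simp add: cmod_reflect)

lemma cmod_reflect_less: "0 < \<tau> \<Longrightarrow> \<tau> < Re x \<Longrightarrow> cmod (reflect \<tau> x) < cmod x"
  by (rule power2_less_imp_less[OF _ norm_ge_zero]) (simp add: cmod_reflect)

lemma w_on_axis: "Re x = \<tau> \<Longrightarrow> w \<tau> i x = 0"
proof -
  assume "Re x = \<tau>"
  then have "reflect \<tau> x = x"
    by (simp add: reflect_def complex_eq_iff)
  then show ?thesis
    by (simp add: w_def)
qed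

lemma V_nonneg: "cmod x \<le> 1 \<Longrightarrow> V i x \<ge> 0"
  using V_bdry[of x i] V_pos[of x i] by (cases "cmod x = 1") auto

lemma V_vec_pos: "cmod x < 1 \<Longrightarrow> (\<chi> j. V j x) \<in> pos_orthant"
  using V_pos by (simp add: pos_orthant_def)

lemma w_cont:
  assumes "0 \<le> \<tau>" and S: "S \<subseteq> {x \<in> cball 0 1. \<tau> \<le> Re x}"
  shows "continuous_on S (w \<tau> i)"
proof -
  have "continuous_on S (\<lambda>x. V i (reflect \<tau> x))"
  proof (rule continuous_on_compose2[OF V_cont])
    show "reflect \<tau> ` S \<subseteq> cball 0 1"
      using cmod_reflect_le[OF \<open>0 \<le> \<tau>\<close>] S by fastforce
  qed (auto simp: reflect_def intro!: continuous_intros)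
  moreover have "continuous_on S (V i)"
    using V_cont by (rule continuous_on_subset) (use S in auto)
  ultimately show ?thesis
    unfolding w_def[abs_def] by (intro continuous_intros)
qed

lemma V_bounded: "\<exists>M>0. \<forall>i x. cmod x \<le> 1 \<longrightarrow> V i x \<le> M"
proof -
  have "\<exists>M. \<forall>x\<in>cball 0 1. V i x \<le> M" for i
  proof -
    have "\<exists>y\<in>cball 0 1. \<forall>x\<in>cball 0 1. V i x \<le> V i y"
      by (intro continuous_attains_sup V_cont) auto
    then show ?thesis
      by blast
  qed
  then obtain M where M: "\<And>i x. x \<in> cball 0 1 \<Longrightarrow> V i x \<le> M i"
    by metis
  have "V i x \<le> (\<Sum>i\<in>UNIV. \<bar>M i\<bar>) + 1" if "cmod x \<le> 1" for i x
  proof -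
    have "V i x \<le> \<bar>M i\<bar>"
      using M[of x i] that by simp
    also have "\<dots> \<le> (\<Sum>i\<in>UNIV. \<bar>M i\<bar>)"
      by (rule member_le_sum) auto
    finally show ?thesis
      by simp
  qed
  moreover have "(\<Sum>i\<in>UNIV. \<bar>M i\<bar>) + 1 > 0"
    by (simp add: add_nonneg_pos sum_nonneg)
  ultimately show ?thesis
    by blast
qed

text \<open>At \<open>x = 2\<tau>\<close> the reflected point is the origin, where the equation is not assumed.\<close>

lemma w_differential_inequality:
  assumes "0 < \<tau>0" "\<tau>0 < 1"
  obtains L where "L \<ge> 0" and
    "\<And>\<tau> i x. \<tau>0 \<le> \<tau> \<Longrightarrow> cmod x < 1 \<Longrightarrow> \<tau> < Re x \<Longrightarrow> x \<noteq> 2 * of_real \<tau> \<Longrightarrow>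
       \<exists>D. has_laplacian (w \<tau> i) D x \<and> D \<le> L * (\<bar>w \<tau> i x\<bar> + (\<Sum>j\<in>UNIV. max 0 (- w \<tau> j x)))"
proof -
  obtain M where M: "M > 0" "\<And>i x. cmod x \<le> 1 \<Longrightarrow> V i x \<le> M"
    using V_bounded by blast
  obtain L where L: "L \<ge> 0"
    and lip: "\<forall>i r a b. \<tau>0 < r \<longrightarrow> r < 1 \<longrightarrow> (\<forall>k. a $ k \<in> {0<..M}) \<longrightarrow> (\<forall>k. b $ k \<in> {0<..M}) \<longrightarrow>
        g i r a - g i r b \<ge> - L * (\<bar>a $ i - b $ i\<bar> + (\<Sum>j\<in>UNIV. max 0 (b $ j - a $ j)))"
    using g_lip[OF assms M(1)] by blast
  show ?thesis
  proof
    show "L \<ge> 0" by fact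
    fix \<tau> i x assume x: "\<tau>0 \<le> \<tau>" "cmod x < 1" "\<tau> < Re x" "x \<noteq> 2 * of_real \<tau>"
    have \<tau>: "\<tau> > 0"
      using x(1) assms by simp
    define y where "y = reflect \<tau> x"
    have y: "cmod y < cmod x" "cmod y < 1"
      using cmod_reflect_less[OF \<tau> x(3)] x(2) by (auto simp: y_def)
    have "y \<noteq> 0"
      using x(4) by (auto simp: y_def reflect_def complex_eq_iff)
    have x_gt: "cmod x > \<tau>0"
      using abs_Re_le_cmod[of x] x by linarith
    then have "x \<noteq> 0"
      using assms by auto
    define a b where "a = (\<chi> j. V j y)" and "b = (\<chi> j. V j x)"
    have "has_laplacian (V i) (- g i (cmod y) a) y"
      using V_eq[of y i] y \<open>y \<noteq> 0\<close> by (simp add: a_def)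
    then have "has_laplacian (V i) (- g i (cmod y) a) (2 * of_real \<tau> - cnj x)"
      by (simp add: y_def reflect_def)
    \<comment> \<open>The reflection is antiholomorphic. It is split into a conjugation and a
      holomorphic map whose derivative has modulus 1, so the Laplacian keeps its value.\<close>
    moreover have "(\<lambda>x. 2 * of_real \<tau> - x) holomorphic_on UNIV"
      by (intro holomorphic_intros)
    moreover have "deriv (\<lambda>x. 2 * of_real \<tau> - x) (cnj x) = -1"
      by (rule DERIV_imp_deriv) (auto intro!: derivative_eq_intros)
    ultimately have "has_laplacian (\<lambda>x. V i (2 * of_real \<tau> - x)) (- g i (cmod y) a) (cnj x)"
      using has_laplacian_compose_holomorphic[of "V i" _ "\<lambda>x. 2 * of_real \<tau> - x" "cnj x" UNIV] by fastforce
    then have "has_laplacian (\<lambda>x. V i (2 * of_real \<tau> - cnj x)) (- g i (cmod y) a) x"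
      by (rule has_laplacian_cnj)
    from has_laplacian_add[OF this has_laplacian_cmult[OF V_eq[OF x(2) \<open>x \<noteq> 0\<close>], of "-1" i]]
    have "has_laplacian (w \<tau> i) (g i (cmod x) b - g i (cmod y) a) x"
      by (simp add: w_def[abs_def] reflect_def b_def)
    \<comment> \<open>The reflected point may be close to the origin, where no uniform Lipschitz
      bound holds. Radial monotonicity moves the comparison to the radius
      \<open>cmod x > \<tau>0\<close>.\<close>
    moreover have "g i (cmod x) b - g i (cmod y) a \<le> g i (cmod x) b - g i (cmod x) a"
      using g_mono[of a "cmod y" "cmod x" i] V_vec_pos[of y] y x(2) \<open>y \<noteq> 0\<close> by (simp add: a_def)
    moreover have "g i (cmod x) a - g i (cmod x) b
       \<ge> - L * (\<bar>a $ i - b $ i\<bar> + (\<Sum>j\<in>UNIV. max 0 (b $ j - a $ j)))"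
      using x(2) x_gt y V_pos M(2) by (intro lip[rule_format]) (auto simp: a_def b_def)
    ultimately show "\<exists>D. has_laplacian (w \<tau> i) D x \<and>
        D \<le> L * (\<bar>w \<tau> i x\<bar> + (\<Sum>j\<in>UNIV. max 0 (- w \<tau> j x)))"
      by (intro exI[of _ "g i (cmod x) b - g i (cmod y) a"]) (simp add: w_def a_def b_def y_def)
  qed
qed

text \<open>Dividing by the strictly superharmonic weight \<open>2 - K (Re x - \<tau>)\<^sup>2\<close> makes the maximum
  principle available in a strip so narrow that the weight stays above 1.\<close>

lemma narrow_strip_principle:
  assumes \<tau>: "0 < \<tau>" and L: "L \<ge> 0"
    and ineq: "\<And>i x. cmod x < 1 \<Longrightarrow> \<tau> < Re x \<Longrightarrow> x \<noteq> 2 * of_real \<tau> \<Longrightarrow>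
       \<exists>D. has_laplacian (w \<tau> i) D x \<and> D \<le> L * (\<bar>w \<tau> i x\<bar> + (\<Sum>j\<in>UNIV. max 0 (- w \<tau> j x)))"
    and K: "K = L * (1 + real CARD('m)) + 1" "K * (b - \<tau>)\<^sup>2 \<le> 1" and b: "\<tau> \<le> b" "b \<le> 2 * \<tau>"
    and right: "\<And>i x. cmod x \<le> 1 \<Longrightarrow> b \<le> Re x \<Longrightarrow> w \<tau> i x \<ge> 0"
    and x: "cmod x \<le> 1" "\<tau> \<le> Re x"
  shows "w \<tau> i x \<ge> 0"
proof (rule ccontr)
  assume neg: "\<not> w \<tau> i x \<ge> 0"
  define S where "S = {x \<in> cball 0 1. \<tau> \<le> Re x} \<inter> {x. Re x \<le> b}"
  define h where "h = (\<lambda>x. 2 - K * (Re x - \<tau>)\<^sup>2)"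
  have K0: "K > 0"
    using L by (simp add: K add_nonneg_pos)
  have h: "1 \<le> h x" "h x \<le> 2" if "x \<in> S" for x
  proof -
    have "(Re x - \<tau>)\<^sup>2 \<le> (b - \<tau>)\<^sup>2"
      using that by (intro power_mono) (auto simp: S_def)
    then have "K * (Re x - \<tau>)\<^sup>2 \<le> 1"
      using order_trans[OF mult_left_mono[OF _ less_imp_le[OF K0]] K(2)] by blast
    then show "1 \<le> h x" "h x \<le> 2"
      using K0 by (auto simp: h_def)
  qed
  have "closed {x. Re x \<le> b}" "closed {x. \<tau> \<le> Re x}"
    by (intro closed_Collect_le continuous_intros)+
  moreover have "S = cball 0 1 \<inter> ({x. \<tau> \<le> Re x} \<inter> {x. Re x \<le> b})"
    by (auto simp: S_def)
  ultimately have "compact S"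
    by (simp add: compact_Int_closed closed_Int)
  have xS: "x \<in> S"
    using neg x right[of x i] by (force simp: S_def)
  have "continuous_on S (\<lambda>x. w \<tau> j x / h x)" for j
  proof (intro continuous_intros)
    show "continuous_on S (w \<tau> j)"
      using \<tau> by (intro w_cont) (auto simp: S_def)
    show "continuous_on S h"
      unfolding h_def by (intro continuous_intros)
    show "\<forall>x\<in>S. h x \<noteq> 0"
      using h by force
  qed
  then have "\<exists>y\<in>S. \<forall>z\<in>S. w \<tau> j y / h y \<le> w \<tau> j z / h z" for j
    using \<open>compact S\<close> xS by (intro continuous_attains_inf) auto
  then obtain \<xi> where \<xi>: "\<And>j. \<xi> j \<in> S" "\<And>j z. z \<in> S \<Longrightarrow> w \<tau> j (\<xi> j) / h (\<xi> j) \<le> w \<tau> j z / h z"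
    by metis
  define Q where "Q = (\<lambda>j. w \<tau> j (\<xi> j) / h (\<xi> j))"
  \<comment> \<open>The component with the lowest quotient controls the negative parts of all the
    others, which is how the coupled system is reduced to one inequality at one point.\<close>
  obtain k where k: "\<And>j. Q k \<le> Q j"
  proof -
    have "Min (range Q) \<in> range Q"
      by (intro Min_in) auto
    then obtain k where "Q k = Min (range Q)"
      by (metis imageE)
    then show ?thesis
      by (intro that[of k]) simp
  qed
  define \<mu> where "\<mu> = - Q k"
  have ge: "- \<mu> * h z \<le> w \<tau> j z" if "z \<in> S" for j z
  proof -
    have "- \<mu> \<le> w \<tau> j z / h z"
      using k[of j] \<xi>(2)[OF that, of j] by (simp add: \<mu>_def Q_def)
    then show ?thesis
      using h(1)[OF that] by (simp add: pos_le_divide_eq)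
  qed
  have \<mu>: "\<mu> > 0"
  proof -
    have "- \<mu> * h x < 0"
      using ge[OF xS, of i] neg by simp
    then show ?thesis
      using h(1)[OF xS] by (simp add: zero_less_mult_iff)
  qed
  define y where "y = \<xi> k"
  have yS: "y \<in> S"
    using \<xi> by (simp add: y_def)
  have wy: "w \<tau> k y = - \<mu> * h y"
    using h(1)[OF yS] by (simp add: \<mu>_def Q_def y_def)
  then have wy_neg: "w \<tau> k y < 0"
    using h(1)[OF yS] \<mu> by (simp add: mult_neg_pos)
  \<comment> \<open>The minimum is interior: \<open>w\<close> is nonnegative on the unit circle
    because \<open>V\<close> vanishes there, zero on the plane, and nonnegative at
    \<open>Re y = b\<close> by the assumption on the right part.\<close>
  have y: "cmod y < 1" "\<tau> < Re y" "Re y < b"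
  proof -
    have yle: "cmod y \<le> 1" "\<tau> \<le> Re y" "Re y \<le> b"
      using yS by (auto simp: S_def)
    have "cmod y \<noteq> 1"
    proof
      assume "cmod y = 1"
      moreover have "cmod (reflect \<tau> y) \<le> 1"
        using cmod_reflect_le[of \<tau> y] \<tau> yle by simp
      ultimately show False
        using wy_neg V_bdry[of y k] V_nonneg[of "reflect \<tau> y" k] by (simp add: w_def)
    qed
    moreover have "Re y \<noteq> \<tau>" "Re y \<noteq> b"
      using w_on_axis[of y \<tau> k] right[of y k] wy_neg yle by auto
    ultimately show "cmod y < 1" "\<tau> < Re y" "Re y < b"
      using yle by auto
  qed
  \<comment> \<open>Here \<open>b \<le> 2 * \<tau>\<close> enters: the strip stops before the point
    whose reflection is the origin.\<close>
  then have "y \<noteq> 2 * of_real \<tau>"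
    using b by auto
  then obtain D where D: "has_laplacian (w \<tau> k) D y"
    "D \<le> L * (\<bar>w \<tau> k y\<bar> + (\<Sum>j\<in>UNIV. max 0 (- w \<tau> j y)))"
    using ineq y by blast
  \<comment> \<open>The weight \<open>h\<close> is put into normal form by
    \<open>(Re x)\<^sup>2 = (Re (x\<^sup>2) + (cmod x)\<^sup>2) / 2\<close>; its trace is
    \<open>- 2 * K\<close>.\<close>
  have "has_laplacian (\<lambda>x. w \<tau> k x + \<mu> * ((2 - K * \<tau>\<^sup>2) + Re (of_real (2 * K * \<tau>) * x)
      + Re (of_real (- K / 2) * x\<^sup>2) + (- 2 * K) / 4 * (cmod x)\<^sup>2)) (D + \<mu> * (- 2 * K)) y"
    by (intro has_laplacian_add has_laplacian_cmult D(1) has_laplacian_quadratic)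
  moreover have "(2 - K * \<tau>\<^sup>2) + Re (of_real (2 * K * \<tau>) * x) + Re (of_real (- K / 2) * x\<^sup>2)
      + (- 2 * K) / 4 * (cmod x)\<^sup>2 = h x" for x :: complex
    unfolding cmod_power2 h_def by (simp add: power2_eq_square field_simps)
  ultimately have lap: "has_laplacian (\<lambda>x. w \<tau> k x + \<mu> * h x) (D + \<mu> * (- 2 * K)) y"
    by (simp only:)
  have "open (ball 0 1 \<inter> {x. \<tau> < Re x} \<inter> {x. Re x < b})"
    by (intro open_Int open_ball open_Collect_less continuous_intros)
  then have "\<forall>\<^sub>F x in nhds y. x \<in> ball 0 1 \<inter> {x. \<tau> < Re x} \<inter> {x. Re x < b}"
    by (rule eventually_nhds_in_open) (use y in auto)
  then have "\<forall>\<^sub>F x in nhds y. w \<tau> k y + \<mu> * h y \<le> w \<tau> k x + \<mu> * h x"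
  proof eventually_elim
    case (elim x)
    then have "x \<in> S"
      by (auto simp: S_def)
    then show ?case
      using ge[of x k] by (simp add: wy)
  qed
  from has_laplacian_nonneg_at_local_min[OF lap this] have "2 * K * \<mu> \<le> D"
    by (simp add: algebra_simps)
  also have "D \<le> L * (2 * \<mu> + (\<Sum>j\<in>(UNIV::'m set). 2 * \<mu>))"
  proof (rule order_trans[OF D(2) mult_left_mono[OF add_mono[OF _ sum_mono] L]])
    have *: "\<mu> * h y \<le> 2 * \<mu>"
      using h(2)[OF yS] \<mu> by simp
    show "\<bar>w \<tau> k y\<bar> \<le> 2 * \<mu>"
      using * wy wy_neg by simp
    show "max 0 (- w \<tau> j y) \<le> 2 * \<mu>" for j
      using ge[OF yS, of j] * \<mu> by (intro max.boundedI) linarith+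
  qed
  \<comment> \<open>Each of the \<open>1 + CARD('m)\<close> terms is at most
    \<open>2 * \<mu>\<close> since \<open>h \<le> 2\<close>. The summand 1 in \<open>K\<close> makes
    the resulting inequality strict enough for a contradiction.\<close>
  also have "\<dots> = 2 * (K - 1) * \<mu>"
    by (simp add: K algebra_simps)
  finally show False
    using \<mu> by (simp add: algebra_simps)
qed

section \<open>Strict positivity beyond an admissible plane\<close>

lemma cap_interior_ball:
  assumes "cmod x < 1" "\<tau> < Re x"
  obtains \<epsilon> where "\<epsilon> > 0" "ball x \<epsilon> \<subseteq> {x. cmod x < 1 \<and> \<tau> < Re x}"
proof -
  have "open (ball 0 1 \<inter> {x. \<tau> < Re x})"
    by (intro open_Int open_ball open_Collect_less continuous_intros)
  moreover have "x \<in> ball 0 1 \<inter> {x. \<tau> < Re x}"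
    using assms by simp
  ultimately obtain \<epsilon> where "\<epsilon> > 0" "ball x \<epsilon> \<subseteq> ball 0 1 \<inter> {x. \<tau> < Re x}"
    using open_contains_ball by blast
  then show ?thesis
    by (intro that[of \<epsilon>]) auto
qed

text \<open>With all components nonnegative, the coupling sum vanishes and the inequality becomes
  scalar. The exceptional point of the barrier is the preimage \<open>2 * \<tau>\<close> of the
  origin under the reflection.\<close>

lemma w_Hopf_barrier:
  assumes \<tau>: "0 < \<tau>" "\<tau> < 1"
    and nonneg: "\<And>i x. cmod x \<le> 1 \<Longrightarrow> \<tau> \<le> Re x \<Longrightarrow> w \<tau> i x \<ge> 0"
    and r: "0 < r" "r < R" "R \<le> 1"
    and cap: "cball c R \<subseteq> {x. cmod x \<le> 1 \<and> \<tau> \<le> Re x}" "ball c R \<subseteq> {x. cmod x < 1 \<and> \<tau> < Re x}"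
    and pos: "\<And>x. x \<in> sphere c r \<Longrightarrow> w \<tau> i x > 0"
  shows "\<exists>\<kappa>>0. \<forall>x\<in>cball c R. r \<le> cmod (x - c) \<longrightarrow> \<kappa> * (R - cmod (x - c)) \<le> w \<tau> i x"
proof -
  obtain L where L: "L \<ge> 0" and
    ineq: "\<And>\<sigma> i x. \<tau> \<le> \<sigma> \<Longrightarrow> cmod x < 1 \<Longrightarrow> \<sigma> < Re x \<Longrightarrow> x \<noteq> 2 * of_real \<sigma> \<Longrightarrow>
       \<exists>D. has_laplacian (w \<sigma> i) D x \<and> D \<le> L * (\<bar>w \<sigma> i x\<bar> + (\<Sum>j\<in>UNIV. max 0 (- w \<sigma> j x)))"
    using w_differential_inequality[OF \<tau>] by blast
  show ?thesis
  proof (rule Hopf_barrier[where L = L and p = "2 * of_real \<tau>"])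
    show "continuous_on (cball c R) (w \<tau> i)"
      using \<tau> cap(1) by (intro w_cont) auto
    show "w \<tau> i x \<ge> 0" if "x \<in> cball c R" for x
      using nonneg that cap(1) by blast
    fix x assume x: "x \<in> ball c R" "x \<noteq> 2 * of_real \<tau>"
    then have "cmod x < 1" "\<tau> < Re x"
      using cap(2) by auto
    then show "\<exists>D. has_laplacian (w \<tau> i) D x \<and> D \<le> L * w \<tau> i x"
      using ineq[of \<tau> x i] x(2) nonneg[of x] by (simp add: less_imp_le)
  qed (use r pos L in auto)
qed

text \<open>A strong maximum principle by connectedness. If positive points came arbitrarily close
  to a zero \<open>y\<close>, the barrier on a ball centred at such a point and containing
  \<open>y\<close> would make \<open>w\<close> positive at \<open>y\<close>. So the zero set is open
  in the cap, and so is the positivity set.\<close>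

lemma w_pos_in_cap:
  assumes \<tau>: "0 < \<tau>" "\<tau> < 1"
    and nonneg: "\<And>i x. cmod x \<le> 1 \<Longrightarrow> \<tau> \<le> Re x \<Longrightarrow> w \<tau> i x \<ge> 0"
    and x: "cmod x < 1" "\<tau> < Re x"
  shows "w \<tau> i x > 0"
proof -
  define C where "C = {x. cmod x < 1 \<and> \<tau> < Re x}"
  have C_eq: "C = ball 0 1 \<inter> {x. \<tau> < Re x}"
    by (auto simp: C_def)
  have "open C"
    unfolding C_eq by (intro open_Int open_ball open_Collect_less continuous_intros)
  have "connected C"
    unfolding C_eq by (intro convex_connected convex_Int convex_ball convex_halfspace_Re_gt)
  have cont: "continuous_on C (w \<tau> i)"
    using \<tau> by (intro w_cont) (auto simp: C_def)
  define P where "P = {x \<in> C. 0 < w \<tau> i x}"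
  have "open P"
  proof -
    have "P = w \<tau> i -` {0<..} \<inter> C"
      by (auto simp: P_def)
    then show ?thesis
      using continuous_on_open_vimage[OF \<open>open C\<close>] cont by (metis open_greaterThan)
  qed
  have "open (C - P)"
    unfolding open_contains_ball
  proof
    fix y assume y: "y \<in> C - P"
    then obtain \<epsilon>0 where \<epsilon>0: "\<epsilon>0 > 0" "ball y \<epsilon>0 \<subseteq> C"
      using cap_interior_ball[of y \<tau>] by (auto simp: C_def)
    \<comment> \<open>Halving ensures that a closed ball of radius \<open>\<epsilon>\<close> around
      any centre within \<open>\<epsilon>\<close> of \<open>y\<close> still lies in the cap; its
      interior contains \<open>y\<close>.\<close>
    define \<epsilon> where "\<epsilon> = min \<epsilon>0 1 / 2"
    have \<epsilon>: "0 < \<epsilon>" "\<epsilon> \<le> 1" "2 * \<epsilon> \<le> \<epsilon>0"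
      using \<epsilon>0 by (auto simp: \<epsilon>_def)
    have "c \<in> C - P" if c: "c \<in> ball y \<epsilon>" for c
    proof (rule ccontr)
      have sub: "cball c \<epsilon> \<subseteq> C"
      proof
        fix z assume "z \<in> cball c \<epsilon>"
        then have "dist y z < \<epsilon>0"
          using dist_triangle[of y z c] c \<epsilon>(3) by simp
        then show "z \<in> C"
          using \<epsilon>0(2) by auto
      qed
      assume "c \<notin> C - P"
      then have "c \<in> P"
        using sub \<epsilon>(1) by (metis DiffI centre_in_cball less_imp_le subsetD)
      then obtain r0 where r0: "r0 > 0" "cball c r0 \<subseteq> P"
        using \<open>open P\<close> open_contains_cball by blast
      define r where "r = min r0 (\<epsilon> / 2)"
      have r: "0 < r" "r < \<epsilon>" "cball c r \<subseteq> P"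
        using r0 \<epsilon> by (auto simp: r_def)
      have "\<exists>\<kappa>>0. \<forall>x\<in>cball c \<epsilon>. r \<le> cmod (x - c) \<longrightarrow> \<kappa> * (\<epsilon> - cmod (x - c)) \<le> w \<tau> i x"
      proof (rule w_Hopf_barrier[OF \<tau> nonneg r(1,2) \<epsilon>(2)])
        show "cball c \<epsilon> \<subseteq> {x. cmod x \<le> 1 \<and> \<tau> \<le> Re x}"
          using sub by (force simp: C_def)
        show "ball c \<epsilon> \<subseteq> {x. cmod x < 1 \<and> \<tau> < Re x}"
          using subset_trans[OF ball_subset_cball sub] by (simp add: C_def)
        show "w \<tau> i x > 0" if "x \<in> sphere c r" for x
          using r(3) that by (auto simp: P_def)
      qed
      then obtain \<kappa> where \<kappa>: "\<kappa> > 0"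
        "\<And>x. x \<in> cball c \<epsilon> \<Longrightarrow> r \<le> cmod (x - c) \<Longrightarrow> \<kappa> * (\<epsilon> - cmod (x - c)) \<le> w \<tau> i x"
        by blast
      have yc: "cmod (y - c) < \<epsilon>"
        using c by (simp add: dist_norm)
      have "0 < w \<tau> i y"
      proof (cases "r \<le> cmod (y - c)")
        case True
        have "0 < \<kappa> * (\<epsilon> - cmod (y - c))"
          using \<kappa>(1) yc by simp
        also have "\<dots> \<le> w \<tau> i y"
          using True yc by (intro \<kappa>(2)) (auto simp: dist_norm norm_minus_commute)
        finally show ?thesis .
      next
        case False
        then have "y \<in> cball c r"
          by (simp add: dist_norm norm_minus_commute)
        then show ?thesis
          using r(3) by (auto simp: P_def)
      qed
      with y show False
        by (auto simp: P_def)
    qed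
    then show "\<exists>e>0. ball y e \<subseteq> C - P"
      using \<epsilon>(1) by blast
  qed
  \<comment> \<open>At the boundary point \<open>1\<close>, \<open>V\<close> vanishes while its
    reflection lies inside the disc, so \<open>w > 0\<close> there. Continuity along the real axis
    carries this into the cap.\<close>
  have "P \<noteq> {}"
  proof -
    have "continuous_on {\<tau>..1} (\<lambda>t. w \<tau> i (of_real t))"
    proof (rule continuous_on_compose2[OF w_cont[OF _ order_refl]])
      show "complex_of_real ` {\<tau>..1} \<subseteq> {x \<in> cball 0 1. \<tau> \<le> Re x}"
        using \<tau> by auto
    qed (use \<tau> in \<open>auto intro!: continuous_intros\<close>)
    then have "((\<lambda>t. w \<tau> i (of_real t)) \<longlongrightarrow> w \<tau> i (of_real 1)) (at_left 1)"
      using \<tau> by (metis continuous_on_Icc_at_leftD)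
    moreover have "w \<tau> i (of_real 1) > 0"
    proof -
      have "cmod (reflect \<tau> 1) < 1"
        using cmod_reflect_less[of \<tau> 1] \<tau> by simp
      then show ?thesis
        using V_pos V_bdry[of 1 i] by (simp add: w_def)
    qed
    ultimately have "\<forall>\<^sub>F t in at_left 1. w \<tau> i (of_real t) > 0"
      by (simp add: order_tendstoD(1))
    moreover have "\<forall>\<^sub>F t in at_left 1. t \<in> {\<tau><..<1}"
      using \<tau> by (intro eventually_at_left_real)
    ultimately have "\<forall>\<^sub>F t in at_left 1. complex_of_real t \<in> P"
    proof eventually_elim
      case (elim t)
      then show ?case
        using \<tau> by (simp add: P_def C_def)
    qed
    then show ?thesis
      using eventually_happens[of _ "at_left (1::real)"] trivial_limit_at_left_real by blast
  qed
  have "P \<subseteq> C" "P \<inter> C = P"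
    by (auto simp: P_def)
  have "C - P = {}"
  proof (rule ccontr)
    assume "C - P \<noteq> {}"
    then have "P \<inter> C = {}"
      using connectedD[OF \<open>connected C\<close> \<open>open P\<close> \<open>open (C - P)\<close>] by blast
    with \<open>P \<inter> C = P\<close> \<open>P \<noteq> {}\<close> show False
      by simp
  qed
  then show ?thesis
    using x by (auto simp: P_def C_def)
qed

section \<open>Advancing the plane\<close>

lemma w_nonneg_step:
  assumes \<tau>0: "0 < \<tau>0" "\<tau>0 < 1" and \<tau>: "\<tau>0 \<le> \<tau>" "\<tau> \<le> 1"
    and nonneg: "\<And>i x. cmod x \<le> 1 \<Longrightarrow> \<tau> \<le> Re x \<Longrightarrow> w \<tau> i x \<ge> 0"
  shows "\<exists>\<delta>>0. \<forall>\<sigma>. \<tau>0 \<le> \<sigma> \<longrightarrow> \<tau> - \<delta> < \<sigma> \<longrightarrow> \<sigma> \<le> \<tau> \<longrightarrow>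
     (\<forall>i x. cmod x \<le> 1 \<longrightarrow> \<sigma> \<le> Re x \<longrightarrow> w \<sigma> i x \<ge> 0)"
proof -
  obtain L where L: "L \<ge> 0" and
    ineq: "\<And>\<sigma> i x. \<tau>0 \<le> \<sigma> \<Longrightarrow> cmod x < 1 \<Longrightarrow> \<sigma> < Re x \<Longrightarrow> x \<noteq> 2 * of_real \<sigma> \<Longrightarrow>
       \<exists>D. has_laplacian (w \<sigma> i) D x \<and> D \<le> L * (\<bar>w \<sigma> i x\<bar> + (\<Sum>j\<in>UNIV. max 0 (- w \<sigma> j x)))"
    using w_differential_inequality[OF \<tau>0] by blast
  define K where "K = L * (1 + real CARD('m)) + 1"
  have K: "K \<ge> 1"
    using L by (simp add: K_def)
  \<comment> \<open>The strip from \<open>\<sigma>\<close> to \<open>\<tau> + \<eta>\<close> is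
    narrower than \<open>2 * \<eta> \<le> 1 / K\<close>, as the weight requires. The bound by
    \<open>\<tau>0 / 3\<close> keeps its right end below \<open>2 * \<sigma>\<close>.\<close>
  define \<eta> where "\<eta> = min (\<tau>0 / 3) (1 / (2 * K))"
  have \<eta>: "0 < \<eta>" "3 * \<eta> \<le> \<tau>0" "2 * \<eta> \<le> 1 / K"
    using \<tau>0 K by (auto simp: \<eta>_def min_def field_simps)
  define S where "S = {x \<in> cball 0 1. \<tau> + \<eta> \<le> Re x}"
  have S: "compact S"
  proof -
    have "S = cball 0 1 \<inter> {x. \<tau> + \<eta> \<le> Re x}"
      by (auto simp: S_def)
    moreover have "closed {x. \<tau> + \<eta> \<le> Re x}"
      by (intro closed_Collect_le continuous_intros)
    ultimately show ?thesis
      by (simp add: compact_Int_closed)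
  qed
  have pos_S: "w \<tau> i x > 0" if "x \<in> S" for i x
  proof -
    have x: "cmod x \<le> 1" "\<tau> < Re x"
      using that \<eta> by (auto simp: S_def)
    then have "\<tau> < 1"
      using abs_Re_le_cmod[of x] by linarith
    show ?thesis
    proof (cases "cmod x < 1")
      case True
      then show ?thesis
        using w_pos_in_cap[OF _ \<open>\<tau> < 1\<close> nonneg] \<tau>0 \<tau> x by auto
    next
      case False
      then have "cmod x = 1" "cmod (reflect \<tau> x) < 1"
        using x cmod_reflect_less[of \<tau> x] \<tau>0 \<tau> by auto
      then show ?thesis
        using V_pos V_bdry by (simp add: w_def)
    qed
  qed
  have "\<exists>m>0. \<forall>x\<in>S. m \<le> w \<tau> i x" for i
  \<comment> \<open>\<open>S\<close> is empty when \<open>\<tau> + \<eta> > 1\<close>, in particular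
    at the starting position \<open>\<tau> = 1\<close>. The narrow strip is then the whole cap, so
    starting needs no argument of its own.\<close>
  proof (cases "S = {}")
    case False
    have "continuous_on S (w \<tau> i)"
      using \<tau>0 \<tau> \<eta> by (intro w_cont) (auto simp: S_def)
    then obtain y where "y \<in> S" "\<And>x. x \<in> S \<Longrightarrow> w \<tau> i y \<le> w \<tau> i x"
      using continuous_attains_inf[OF S False] by blast
    then show ?thesis
      using pos_S by blast
  qed (auto intro: exI[of _ 1])
  then obtain m where m: "\<And>i. m i > 0" "\<And>i x. x \<in> S \<Longrightarrow> m i \<le> w \<tau> i x"
    by metis
  have "\<exists>d>0. \<forall>x\<in>cball 0 1. \<forall>y\<in>cball 0 1. dist x y < d \<longrightarrow> dist (V i x) (V i y) < m i" for i
    using compact_uniformly_continuous[OF V_cont[of i] compact_cball] m(1)[of i]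
    unfolding uniformly_continuous_on_def by (metis dist_commute)
  then obtain d where d: "\<And>i. d i > 0"
    "\<And>i x y. x \<in> cball 0 1 \<Longrightarrow> y \<in> cball 0 1 \<Longrightarrow> dist x y < d i \<Longrightarrow> dist (V i x) (V i y) < m i"
    by metis
  \<comment> \<open>Moving the plane from \<open>\<tau>\<close> to \<open>\<sigma>\<close> shifts
    reflected points by \<open>2 * (\<tau> - \<sigma>) < 2 * \<delta>\<close>. This changes
    \<open>V i\<close> by less than the lower bound \<open>m i\<close> of \<open>w\<close> on
    \<open>S\<close>.\<close>
  define \<delta> where "\<delta> = min \<eta> (Min (range d) / 2)"
  have "Min (range d) > 0"
    using d(1) by (subst Min_gr_iff) auto
  then have \<delta>: "\<delta> > 0" "\<delta> \<le> \<eta>" "\<And>i. 2 * \<delta> \<le> d i"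
  proof -
    show "2 * \<delta> \<le> d i" for i
    proof -
      have "Min (range d) \<le> d i"
        by simp
      then show ?thesis
        unfolding \<delta>_def by linarith
    qed
  qed (use \<eta> in \<open>auto simp: \<delta>_def\<close>)
  have "w \<sigma> i x \<ge> 0"
    if \<sigma>: "\<tau>0 \<le> \<sigma>" "\<tau> - \<delta> < \<sigma>" "\<sigma> \<le> \<tau>" and x: "cmod x \<le> 1" "\<sigma> \<le> Re x" for \<sigma> i x
  proof (rule narrow_strip_principle[where b = "\<tau> + \<eta>", OF _ L _ K_def])
    show "0 < \<sigma>"
      using \<tau>0 \<sigma> by simp
    show "K * (\<tau> + \<eta> - \<sigma>)\<^sup>2 \<le> 1"
    proof -
      have "(\<tau> + \<eta> - \<sigma>)\<^sup>2 \<le> (1 / K)\<^sup>2"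
        using \<sigma> \<delta> \<eta> by (intro power_mono) auto
      then have "K * (\<tau> + \<eta> - \<sigma>)\<^sup>2 \<le> K * (1 / K)\<^sup>2"
        using K by (intro mult_left_mono) auto
      also have "\<dots> \<le> 1"
        using K by (simp add: power2_eq_square field_simps)
      finally show ?thesis .
    qed
    show "\<tau> + \<eta> \<le> 2 * \<sigma>" "\<sigma> \<le> \<tau> + \<eta>"
      using \<sigma> \<tau> \<delta> \<eta> by auto
    show "cmod x \<le> 1" "\<sigma> \<le> Re x"
      using x by auto
    show "w \<sigma> i x \<ge> 0" if x: "cmod x \<le> 1" "\<tau> + \<eta> \<le> Re x" for i x
    proof -
      have "cmod (reflect \<sigma> x) \<le> 1" "cmod (reflect \<tau> x) \<le> 1"
        using cmod_reflect_le[of \<sigma> x] cmod_reflect_le[of \<tau> x] x \<sigma> \<tau>0 \<tau> \<eta> by auto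
      moreover have "dist (reflect \<sigma> x) (reflect \<tau> x) < d i"
      proof -
        have "reflect \<sigma> x - reflect \<tau> x = of_real (2 * (\<sigma> - \<tau>))"
          by (simp add: reflect_def)
        then have "dist (reflect \<sigma> x) (reflect \<tau> x) = \<bar>2 * (\<sigma> - \<tau>)\<bar>"
          by (simp only: dist_norm norm_of_real)
        also have "\<dots> = 2 * (\<tau> - \<sigma>)"
          using \<sigma>(3) by simp
        also have "\<dots> < 2 * \<delta>"
          using \<sigma> by simp
        finally show ?thesis
          using \<delta>(3)[of i] by simp
      qed
      ultimately have "dist (V i (reflect \<sigma> x)) (V i (reflect \<tau> x)) < m i"
        by (intro d) auto
      moreover have "m i \<le> w \<tau> i x"
        using m(2) x by (auto simp: S_def)
      ultimately show ?thesis
        by (simp add: w_def dist_real_def)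
    qed
  qed (use ineq \<sigma> in auto)
  with \<delta>(1) show ?thesis
    by blast
qed

lemma tendsto_w:
  assumes "cmod x \<le> 1" "\<sigma> < Re x" "0 \<le> \<sigma>"
  shows "((\<lambda>\<tau>. w \<tau> i x) \<longlongrightarrow> w \<sigma> i x) (at_right \<sigma>)"
proof -
  have "continuous_on {\<sigma>..Re x} (\<lambda>\<tau>. V i (reflect \<tau> x))"
  proof (rule continuous_on_compose2[OF V_cont])
    have "reflect \<tau> x \<in> cball 0 1" if "\<tau> \<in> {\<sigma>..Re x}" for \<tau>
      using cmod_reflect_le[of \<tau> x] assms that by simp
    then show "(\<lambda>\<tau>. reflect \<tau> x) ` {\<sigma>..Re x} \<subseteq> cball 0 1"
      by blast
  qed (auto simp: reflect_def intro!: continuous_intros)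
  then have "((\<lambda>\<tau>. V i (reflect \<tau> x)) \<longlongrightarrow> V i (reflect \<sigma> x)) (at_right \<sigma>)"
    using assms(2) by (metis continuous_on_Icc_at_rightD)
  then show ?thesis
    unfolding w_def by (intro tendsto_intros)
qed

text \<open>A continuity argument in the position of the plane: admissibility survives limits from
  the right, and the step lemma pushes any admissible position above \<open>\<sigma>\<close> further
  left.\<close>

lemma w_nonneg:
  assumes \<sigma>: "0 < \<sigma>" and x: "cmod x \<le> 1" "\<sigma> \<le> Re x"
  shows "w \<sigma> i x \<ge> 0"
proof (cases "\<sigma> < 1")
  case False
  then have "Re x = \<sigma>"
    using abs_Re_le_cmod[of x] x by linarith
  then show ?thesis
    by (simp add: w_on_axis)
next
  case True
  define N where "N = (\<lambda>\<tau>. \<forall>i x. cmod x \<le> 1 \<longrightarrow> \<tau> \<le> Re x \<longrightarrow> w \<tau> i x \<ge> 0)"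
  \<comment> \<open>Admissibility is demanded on the whole interval up to \<open>1\<close>, so that
    every position above the infimum is known to be admissible.\<close>
  define T where "T = {\<tau> \<in> {\<sigma>..1}. \<forall>\<rho>\<in>{\<tau>..1}. N \<rho>}"
  define l where "l = Inf T"
  have "N 1"
    unfolding N_def
  proof (intro allI impI)
    fix i x assume "cmod x \<le> 1" "1 \<le> Re x"
    then have "Re x = 1"
      using abs_Re_le_cmod[of x] by linarith
    then show "w 1 i x \<ge> 0"
      by (simp add: w_on_axis)
  qed
  then have "1 \<in> T"
    using True by (auto simp: T_def)
  have bdd: "bdd_below T"
    by (auto simp: T_def intro: bdd_belowI[of _ \<sigma>])
  have l: "\<sigma> \<le> l" "l \<le> 1"
    unfolding l_def using \<open>1 \<in> T\<close> bdd by (auto intro!: cInf_greatest cInf_lower simp: T_def)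
  have above: "N \<rho>" if "l < \<rho>" "\<rho> \<le> 1" for \<rho>
  proof -
    obtain \<tau> where "\<tau> \<in> T" "\<tau> < \<rho>"
      using \<open>l < \<rho>\<close> \<open>1 \<in> T\<close> unfolding l_def by (metis cInf_lessD empty_iff)
    then show ?thesis
      using that by (auto simp: T_def)
  qed
  have "N l"
    unfolding N_def
  proof (intro allI impI)
    fix i x assume x: "cmod x \<le> 1" "l \<le> Re x"
    show "w l i x \<ge> 0"
    proof (cases "Re x = l")
      case False
      then have lx: "l < Re x" "Re x \<le> 1"
        using x abs_Re_le_cmod[of x] by auto
      then have "\<forall>\<^sub>F \<tau> in at_right l. \<tau> \<in> {l<..<Re x}"
        by (intro eventually_at_right_real)
      then have "\<forall>\<^sub>F \<tau> in at_right l. 0 \<le> w \<tau> i x"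
      proof eventually_elim
        case (elim \<tau>)
        then have "N \<tau>"
          using lx by (intro above) auto
        then show ?case
          using elim x by (auto simp: N_def)
      qed
      moreover have "((\<lambda>\<tau>. w \<tau> i x) \<longlongrightarrow> w l i x) (at_right l)"
        using x lx l \<sigma> by (intro tendsto_w) auto
      ultimately show ?thesis
        by (intro tendsto_lowerbound) auto
    qed (simp add: w_on_axis)
  qed
  have "l = \<sigma>"
  proof (rule ccontr)
    assume "l \<noteq> \<sigma>"
    then have "\<sigma> < l"
      using l by simp
    \<comment> \<open>The target \<open>\<sigma>\<close> itself serves as the positive lower bound
      for positions, which fixes the Lipschitz constant along the way.\<close>
    obtain \<delta> where \<delta>: "\<delta> > 0" "\<And>\<rho>. \<sigma> \<le> \<rho> \<Longrightarrow> l - \<delta> < \<rho> \<Longrightarrow> \<rho> \<le> l \<Longrightarrow> N \<rho>"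
      using w_nonneg_step[OF \<sigma> True l] \<open>N l\<close> unfolding N_def by metis
    define \<tau> where "\<tau> = max \<sigma> (l - \<delta> / 2)"
    have \<tau>: "\<sigma> \<le> \<tau>" "l - \<delta> < \<tau>" "\<tau> < l"
      using \<delta>(1) \<open>\<sigma> < l\<close> by (auto simp: \<tau>_def)
    have "\<tau> \<in> T"
    proof -
      have "N \<rho>" if "\<tau> \<le> \<rho>" "\<rho> \<le> 1" for \<rho>
        using that \<tau> \<delta>(2)[of \<rho>] above[of \<rho>] by (cases "\<rho> \<le> l") auto
      then show ?thesis
        using \<tau> l by (auto simp: T_def)
    qed
    then show False
      using cInf_lower[OF _ bdd] \<tau>(3) by (force simp: l_def)
  qed
  with \<open>N l\<close> x show ?thesis
    by (simp add: N_def)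
qed

section \<open>The limit position: radial symmetry and strict decrease\<close>

lemma reflect_imaginary_axis_le:
  assumes "cmod x \<le> 1" "0 \<le> Re x"
  shows "V i x \<le> V i (- cnj x)"
proof (cases "Re x = 0")
  case True
  then have "- cnj x = x"
    by (simp add: complex_eq_iff)
  then show ?thesis
    by simp
next
  case False
  have "\<forall>\<^sub>F \<tau> in at_right 0. \<tau> \<in> {0<..<Re x}"
    using False assms by (intro eventually_at_right_real) auto
  then have "\<forall>\<^sub>F \<tau> in at_right 0. 0 \<le> w \<tau> i x"
    by eventually_elim (use w_nonneg assms in auto)
  moreover have "((\<lambda>\<tau>. w \<tau> i x) \<longlongrightarrow> w 0 i x) (at_right 0)"
    using False assms by (intro tendsto_w) auto
  ultimately have "0 \<le> w 0 i x"
    by (intro tendsto_lowerbound) auto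
  then show ?thesis
    by (simp add: w_def reflect_def)
qed

text \<open>The ball around \<open>c\<close> touches the plane at the real point
  \<open>\<tau>\<close> from the right. Near the point of contact the barrier is linear in the
  distance from the plane, which bounds the difference of \<open>V\<close> across the plane from
  below.\<close>

lemma Hopf_on_real_axis:
  assumes \<tau>: "0 < \<tau>" "\<tau> < 1"
  obtains \<kappa> R where "\<kappa> > 0" "R > 0" "\<And>t. 0 \<le> t \<Longrightarrow> t \<le> R \<Longrightarrow>
     \<kappa> * t \<le> V i (of_real (\<tau> - t)) - V i (of_real (\<tau> + t))"
proof -
  \<comment> \<open>A third of the remaining length leaves \<open>\<tau> + 2 * R < 1\<close>, so the
    tangent ball stays inside the unit disc.\<close>
  define R where "R = (1 - \<tau>) / 3"
  define c where "c = complex_of_real (\<tau> + R)"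
  have R: "R > 0" "R \<le> 1" "\<tau> + 2 * R < 1"
    using \<tau> by (auto simp: R_def field_simps)
  have norm_c: "cmod c = \<tau> + R"
    unfolding c_def norm_of_real using \<tau> R by simp
  have cap: "cmod x \<le> \<tau> + R + cmod (x - c)" "\<tau> + R - cmod (x - c) \<le> Re x" for x
  proof -
    show "cmod x \<le> \<tau> + R + cmod (x - c)"
      using norm_triangle_ineq[of c "x - c"] by (simp add: norm_c)
    show "\<tau> + R - cmod (x - c) \<le> Re x"
      using abs_Re_le_cmod[of "x - c"] by (simp add: c_def)
  qed
  have sub: "cball c R \<subseteq> {x. cmod x \<le> 1 \<and> \<tau> \<le> Re x}" "ball c R \<subseteq> {x. cmod x < 1 \<and> \<tau> < Re x}"
  proof -
    show "cball c R \<subseteq> {x. cmod x \<le> 1 \<and> \<tau> \<le> Re x}"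
    proof
      fix x assume "x \<in> cball c R"
      then show "x \<in> {x. cmod x \<le> 1 \<and> \<tau> \<le> Re x}"
        using cap[of x] R by (simp add: dist_norm norm_minus_commute)
    qed
    show "ball c R \<subseteq> {x. cmod x < 1 \<and> \<tau> < Re x}"
    proof
      fix x assume "x \<in> ball c R"
      then show "x \<in> {x. cmod x < 1 \<and> \<tau> < Re x}"
        using cap[of x] R by (simp add: dist_norm norm_minus_commute)
    qed
  qed
  have nonneg: "w \<tau> i x \<ge> 0" if "cmod x \<le> 1" "\<tau> \<le> Re x" for i x
    using w_nonneg \<tau> that by blast
  have "\<exists>\<kappa>>0. \<forall>x\<in>cball c R. R / 2 \<le> cmod (x - c) \<longrightarrow> \<kappa> * (R - cmod (x - c)) \<le> w \<tau> i x"
  proof (rule w_Hopf_barrier[OF \<tau> nonneg _ _ R(2) sub])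
    fix x assume "x \<in> sphere c (R / 2)"
    then have "x \<in> ball c R"
      using R by simp
    then show "w \<tau> i x > 0"
      using w_pos_in_cap[OF \<tau> nonneg] sub(2) by blast
  qed (use R in auto)
  then obtain \<kappa> where \<kappa>: "\<kappa> > 0"
    "\<And>x. x \<in> cball c R \<Longrightarrow> R / 2 \<le> cmod (x - c) \<Longrightarrow> \<kappa> * (R - cmod (x - c)) \<le> w \<tau> i x"
    by blast
  show ?thesis
  proof (rule that[of \<kappa> "R / 2"])
    fix t :: real assume t: "0 \<le> t" "t \<le> R / 2"
    have "of_real (\<tau> + t) - c = of_real (t - R)"
      by (simp add: c_def)
    then have norm: "cmod (of_real (\<tau> + t) - c) = R - t"
      using t R by (simp only: norm_of_real)
    then have "\<kappa> * t \<le> w \<tau> i (of_real (\<tau> + t))"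
      using \<kappa>(2)[of "of_real (\<tau> + t)"] t R by (simp add: dist_norm norm_minus_commute)
    also have "reflect \<tau> (of_real (\<tau> + t)) = of_real (\<tau> - t)"
      by (simp add: reflect_def)
    then have "w \<tau> i (of_real (\<tau> + t)) = V i (of_real (\<tau> - t)) - V i (of_real (\<tau> + t))"
      by (simp only: w_def)
    finally show "\<kappa> * t \<le> V i (of_real (\<tau> - t)) - V i (of_real (\<tau> + t))" .
  qed (use \<kappa> R in auto)
qed

text \<open>The nonlinearity sees the position only through \<open>cmod x\<close>, and a rotation is
  holomorphic with derivative of modulus 1. Hence every result for planes orthogonal to the real
  axis holds in all directions.\<close>

lemma rotate:
  assumes "cmod e = 1"
  shows "cooperative_system_on_disc (\<lambda>i z. V i (e * z)) g"
proof
  have e: "cmod (e * z) = cmod z" for z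
    using assms by (simp add: norm_mult)
  have "e \<noteq> 0"
    using assms by auto
  show "continuous_on (cball 0 1) (\<lambda>z. V i (e * z))" for i
    by (rule continuous_on_compose2[OF V_cont]) (auto simp: e intro!: continuous_intros)
  show "V i (e * x) = 0" if "cmod x = 1" for i x
    using V_bdry that by (simp add: e)
  show "V i (e * x) > 0" if "cmod x < 1" for i x
    using V_pos that by (simp add: e)
  show "has_laplacian (\<lambda>z. V i (e * z)) (- g i (cmod x) (\<chi> j. V j (e * x))) x"
    if "cmod x < 1" "x \<noteq> 0" for i x
  proof -
    have "has_laplacian (V i) (- g i (cmod x) (\<chi> j. V j (e * x))) (e * x)"
      using V_eq[of "e * x" i] that \<open>e \<noteq> 0\<close> by (simp add: e)
    moreover have "(\<lambda>z. e * z) holomorphic_on UNIV"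
      by (intro holomorphic_intros)
    ultimately have "has_laplacian (\<lambda>z. V i (e * z))
        ((cmod (deriv (\<lambda>z. e * z) x))\<^sup>2 * (- g i (cmod x) (\<chi> j. V j (e * x)))) x"
      by (rule has_laplacian_compose_holomorphic) auto
    moreover have "deriv (\<lambda>z. e * z) x = e"
      by (rule DERIV_imp_deriv) (auto intro!: derivative_eq_intros)
    ultimately show ?thesis
      using assms by simp
  qed
qed (use g_mono g_lip in auto)

text \<open>Since \<open>cmod x = cmod y\<close>, the perpendicular bisector of the two points
  passes through the origin. Rotating by the direction \<open>e\<close> of \<open>x - y\<close>
  turns it into the imaginary axis, with \<open>x\<close> on the right and \<open>y\<close> as its
  mirror image.\<close>

lemma V_radial_le:
  assumes "cmod x \<le> 1" "cmod x = cmod y" "x \<noteq> y"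
  shows "V i x \<le> V i y"
proof -
  define e where "e = (x - y) / cmod (x - y)"
  have e: "cmod e = 1"
    using assms(3) by (simp add: e_def norm_divide)
  then have e0: "e \<noteq> 0"
    by auto
  have ec: "cnj e = 1 / e"
    using complex_norm_square[of e] e e0 by (simp add: field_simps)
  have sq: "x * cnj x = y * cnj y"
    using assms(2) by (metis complex_norm_square)
  interpret rot: cooperative_system_on_disc "\<lambda>i z. V i (e * z)" g
    by (rule rotate[OF e])
  define z where "z = cnj e * x"
  have "e * z = x"
    using e0 by (simp add: z_def ec)
  have "cmod z \<le> 1"
    using assms(1) e by (simp add: z_def norm_mult)
  moreover have "Re z \<ge> 0"
  proof -
    have "Re (cnj (x - y) * x) = ((cmod (x - y))\<^sup>2 + ((cmod x)\<^sup>2 - (cmod y)\<^sup>2)) / 2"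
      unfolding cmod_power2 by (simp add: power2_eq_square algebra_simps)
    also have "\<dots> = (cmod (x - y))\<^sup>2 / 2"
      using assms(2) by simp
    finally have "Re (cnj (x - y) * x) = (cmod (x - y))\<^sup>2 / 2" .
    then have "Re (cnj (x - y) * x) \<ge> 0"
      by (simp only:) simp
    moreover have "z = of_real (1 / cmod (x - y)) * (cnj (x - y) * x)"
      by (simp add: z_def e_def)
    then have "Re z = (1 / cmod (x - y)) * Re (cnj (x - y) * x)"
      by (simp only: Re_of_real_mult)
    ultimately show ?thesis
      by simp
  qed
  ultimately have "V i (e * z) \<le> V i (e * (- cnj z))"
    by (rule rot.reflect_imaginary_axis_le)
  moreover have "e * (- cnj z) = y"
  proof -
    have "x - y = cmod (x - y) * e"
      using assms(3) by (simp add: e_def)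
    then have "cnj (x - y) = cmod (x - y) * cnj e"
      by (metis complex_cnj_complex_of_real complex_cnj_mult)
    then have "e * cnj (x - y) = cnj e * (x - y)"
      using \<open>x - y = cmod (x - y) * e\<close> by (metis mult.assoc mult.commute)
    have "e * (- cnj z) * cnj (x - y) = - (e * cnj (x - y)) * e * cnj x"
      by (simp add: z_def algebra_simps)
    also have "\<dots> = - (x - y) * cnj x"
      unfolding \<open>e * cnj (x - y) = cnj e * (x - y)\<close> ec using e0 by simp
    also have "\<dots> = y * cnj (x - y)"
      using sq by (simp add: algebra_simps)
    finally have "e * (- cnj z) * cnj (x - y) = y * cnj (x - y)" .
    moreover have "cnj (x - y) \<noteq> 0"
      using assms(3) by simp
    ultimately show ?thesis
      using mult_right_cancel by blast
  qed
  ultimately show ?thesis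
    using \<open>e * z = x\<close> by simp
qed

lemma V_radial:
  assumes "cmod x \<le> 1" "cmod x = cmod y"
  shows "V i x = V i y"
proof (cases "x = y")
  case False
  have "cmod y \<le> 1"
    using assms by (rule back_subst[of "\<lambda>r. r \<le> 1"])
  show ?thesis
    using V_radial_le[OF assms False] V_radial_le[OF \<open>cmod y \<le> 1\<close> assms(2)[symmetric] False[symmetric]]
    by (rule antisym)
qed simp

text \<open>The derivative at \<open>0\<close> of the difference across the plane is minus twice the
  radial derivative, and the linear lower bound makes it at least
  \<open>\<kappa> > 0\<close>.\<close>

lemma V_radial_derivative_neg:
  assumes \<rho>: "0 < \<rho>" "\<rho> < 1"
  shows "\<exists>d<0. ((\<lambda>t. V i (of_real t)) has_real_derivative d) (at \<rho>)"
proof -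
  have "has_laplacian (V i) (- g i (cmod \<rho>) (\<chi> j. V j \<rho>)) \<rho>"
    using \<rho> by (intro V_eq) auto
  then obtain a where a: "((\<lambda>t. V i (of_real t)) has_real_derivative Re a) (at \<rho>)"
    using has_laplacian_imp_DERIV by blast
  obtain \<kappa> R where \<kappa>: "\<kappa> > 0" "R > 0" "\<And>t. 0 \<le> t \<Longrightarrow> t \<le> R \<Longrightarrow>
     \<kappa> * t \<le> V i (of_real (\<rho> - t)) - V i (of_real (\<rho> + t))"
    using Hopf_on_real_axis[OF \<rho>] by blast
  have "((\<lambda>t. V i (of_real (\<rho> - t)) - V i (of_real (\<rho> + t))) has_real_derivative - Re a - Re a) (at 0)"
  proof -
    have "((\<lambda>t. V i (of_real (\<rho> + t))) has_real_derivative Re a * 1) (at 0)"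
      by (rule DERIV_chain2[where f = "\<lambda>t. V i (of_real t)"]) (use a in \<open>auto intro!: derivative_eq_intros\<close>)
    moreover have "((\<lambda>t. V i (of_real (\<rho> - t))) has_real_derivative Re a * (- 1)) (at 0)"
      by (rule DERIV_chain2[where f = "\<lambda>t. V i (of_real t)"]) (use a in \<open>auto intro!: derivative_eq_intros\<close>)
    ultimately show ?thesis
      by (auto intro!: derivative_eq_intros)
  qed
  then have "((\<lambda>t. (V i (of_real (\<rho> - t)) - V i (of_real (\<rho> + t))) / t) \<longlongrightarrow> - 2 * Re a) (at_right 0)"
    by (auto simp: DERIV_def intro: filterlim_mono at_le elim!: filterlim_mono[OF _ order_refl at_le])
  moreover have "\<forall>\<^sub>F t in at_right 0. t \<in> {0<..<R}"
    using \<kappa>(2) by (intro eventually_at_right_real)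
  then have "\<forall>\<^sub>F t in at_right 0. \<kappa> \<le> (V i (of_real (\<rho> - t)) - V i (of_real (\<rho> + t))) / t"
    by eventually_elim (use \<kappa>(3) in \<open>auto simp: pos_le_divide_eq\<close>)
  ultimately have "\<kappa> \<le> - 2 * Re a"
    by (intro tendsto_lowerbound) auto
  with \<kappa>(1) a show ?thesis
    by (intro exI[of _ "Re a"]) auto
qed

end

subsection \<open>Unfolding by the power map\<close>

text \<open>Go from \<open>b\<close> to \<open>a\<close> one coordinate at a time and apply the mean
  value theorem to each move. All intermediate points stay in the box, where the derivative bound
  holds.\<close>

lemma cooperative_increment:
  fixes F :: "real ^ 'm::finite \<Rightarrow> real" and a b :: "real ^ 'm"
  assumes diff: "\<And>j v. v \<in> pos_orthant \<Longrightarrow> (\<lambda>t. F (v + t *\<^sub>R axis j 1)) differentiable (at 0)"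
    and coop: "\<And>j v. j \<noteq> i \<Longrightarrow> v \<in> pos_orthant \<Longrightarrow> pderiv_at j F v \<ge> 0"
    and bound: "\<And>j v. (\<And>k. v $ k \<in> {0<..M}) \<Longrightarrow> \<bar>pderiv_at j F v\<bar> \<le> B"
    and a: "\<And>k. a $ k \<in> {0<..M}" and b: "\<And>k. b $ k \<in> {0<..M}"
  shows "F a - F b \<ge> - B * (\<bar>a $ i - b $ i\<bar> + (\<Sum>j\<in>UNIV. max 0 (b $ j - a $ j)))"
proof -
  have B: "B \<ge> 0"
    using bound[OF a, of i] by linarith
  \<comment> \<open>The loss allowed per coordinate, up to the factor \<open>B\<close>: changing
    coordinate \<open>i\<close> may cost in either direction, any other coordinate only when it is
    lowered.\<close>
  define e where "e = (\<lambda>j. if j = i then \<bar>a $ i - b $ i\<bar> else max 0 (b $ j - a $ j))"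
  define c where "c = (\<lambda>A. \<chi> j. if j \<in> A then a $ j else b $ j)"
  have "F (c A) - F b \<ge> - B * (\<Sum>j\<in>A. e j)" if "finite A" for A
    using that
  proof (induction A rule: finite_induct)
    case empty
    have "c {} = b"
      by (simp add: c_def vec_eq_iff)
    then show ?case
      by simp
  next
    case (insert k A)
    define p q where "p = b $ k" and "q = a $ k"
    define y where "y = (\<lambda>s. \<chi> j. if j = k then s else c A $ j)"
    have y_box: "y s $ j \<in> {0<..M}" if "s \<in> {min p q..max p q}" for s j
      using that a[of j] b[of j] by (auto simp: y_def c_def p_def q_def)
    have y_pos: "y s \<in> pos_orthant" if "s \<in> {min p q..max p q}" for s
      using y_box[OF that] by (auto simp: pos_orthant_def)
    have deriv: "((\<lambda>s. F (y s)) has_real_derivative pderiv_at k F (y s)) (at s)"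
      if "s \<in> {min p q..max p q}" for s
    proof -
      have "y s + t *\<^sub>R axis k 1 = y (t + s)" for t
        by (simp add: y_def vec_eq_iff axis_def)
      then show ?thesis
        using diff[OF y_pos[OF that], of k] DERIV_shift[of "\<lambda>s. F (y s)" "pderiv_at k F (y s)" 0 s]
        by (simp add: pderiv_at_def DERIV_deriv_iff_real_differentiable)
    qed
    have "\<exists>\<zeta>\<in>{min p q..max p q}. F (y q) - F (y p) = (q - p) * pderiv_at k F (y \<zeta>)"
    proof (cases p q rule: linorder_cases)
      case less
      then obtain \<zeta> where "p < \<zeta>" "\<zeta> < q" "F (y q) - F (y p) = (q - p) * pderiv_at k F (y \<zeta>)"
        using MVT2[of p q "\<lambda>s. F (y s)" "\<lambda>s. pderiv_at k F (y s)"] deriv by auto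
      with less show ?thesis
        by (intro bexI[of _ \<zeta>]) auto
    next
      case greater
      then obtain \<zeta> where "q < \<zeta>" "\<zeta> < p" "F (y p) - F (y q) = (p - q) * pderiv_at k F (y \<zeta>)"
        using MVT2[of q p "\<lambda>s. F (y s)" "\<lambda>s. pderiv_at k F (y s)"] deriv by auto
      with greater show ?thesis
        by (intro bexI[of _ \<zeta>]) (auto simp: algebra_simps)
    qed auto
    then obtain \<zeta> where \<zeta>: "\<zeta> \<in> {min p q..max p q}"
      "F (y q) - F (y p) = (q - p) * pderiv_at k F (y \<zeta>)"
      by blast
    define d where "d = pderiv_at k F (y \<zeta>)"
    have d: "\<bar>d\<bar> \<le> B"
      unfolding d_def using y_box[OF \<zeta>(1)] by (rule bound)
    have "- B * e k \<le> (q - p) * d"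
    proof (cases "k = i")
      case True
      have "\<bar>(q - p) * d\<bar> \<le> \<bar>q - p\<bar> * B"
        using d by (simp add: abs_mult mult_left_mono)
      then show ?thesis
        using True by (simp add: e_def p_def q_def mult.commute)
    next
      case False
      have d0: "d \<ge> 0"
        using coop[OF False y_pos[OF \<zeta>(1)]] by (simp add: d_def)
      show ?thesis
      proof (cases "p \<le> q")
        case True
        then have "0 \<le> (q - p) * d" "e k = 0"
          using d0 False by (auto simp: e_def p_def q_def)
        then show ?thesis
          by simp
      next
        case False
        then have *: "(p - q) * d \<le> (p - q) * B"
          using d by (intro mult_left_mono) auto
        have ek: "e k = p - q"
          using False \<open>k \<noteq> i\<close> by (simp add: e_def p_def q_def)
        show ?thesis
          unfolding ek using * by (simp add: algebra_simps)
      qed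
    qed
    moreover have "y q = c (insert k A)" "y p = c A"
      using insert by (auto simp: y_def c_def p_def q_def vec_eq_iff)
    ultimately have "F (c (insert k A)) - F (c A) \<ge> - B * e k"
      using \<zeta>(2) by (simp add: d_def)
    with insert show ?case
      by (simp add: algebra_simps)
  qed
  from this[of UNIV] have "F a - F b \<ge> - B * (\<Sum>j\<in>UNIV. e j)"
    by (simp add: c_def)
  \<comment> \<open>The extra nonnegative term at \<open>j = i\<close> only weakens the bound and
    makes the sum uniform over all indices.\<close>
  moreover have "(\<Sum>j\<in>UNIV. e j) \<le> (\<Sum>j\<in>UNIV. (if j = i then \<bar>a $ i - b $ i\<bar> else 0) + max 0 (b $ j - a $ j))"
    by (intro sum_mono) (auto simp: e_def)
  then have "B * (\<Sum>j\<in>UNIV. e j) \<le> B * (\<bar>a $ i - b $ i\<bar> + (\<Sum>j\<in>UNIV. max 0 (b $ j - a $ j)))"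
    using B by (intro mult_left_mono) (auto simp: sum.distrib)
  ultimately show ?thesis
    by simp
qed

lemma continuous_on_vec_of_complex: "continuous_on S vec_of_complex"
proof -
  have eq: "vec_of_complex = (\<lambda>z. \<chi> i. if i = 1 then Re z else Im z)"
    by (simp add: fun_eq_iff vec_of_complex_def vec_eq_iff forall_2)
  have "continuous_on S (\<lambda>z. if i = 1 then Re z else Im z)" for i :: 2
    by (cases "i = 1") (auto intro: continuous_intros)
  then show ?thesis
    unfolding eq by (rule continuous_on_vec_lambda)
qed

text \<open>The root with argument \<open>Arg x / n\<close>, which jumps across the cut of
  \<open>Arg\<close>. It is composed only with functions that are constant on the fibres of
  \<open>z \<mapsto> z ^ n\<close>, for which the choice of root is immaterial.\<close>

definition nth_root :: "nat \<Rightarrow> complex \<Rightarrow> complex" where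
  "nth_root n x = rcis (root n (cmod x)) (Arg x / real n)"

lemma nth_root_power: "n > 0 \<Longrightarrow> nth_root n x ^ n = x"
  by (simp add: nth_root_def DeMoivre2 rcis_cmod_Arg)

lemma cmod_nth_root: "n > 0 \<Longrightarrow> cmod (nth_root n x) = root n (cmod x)"
  by (simp add: nth_root_def)

lemma n_mode_rotation:
  assumes g: "n_mode n g" and z: "cmod z \<le> 1"
  shows "g (vec_of_complex (z * cis (2 * pi / real n) ^ k)) = g (vec_of_complex z)"
proof (induction k)
  case (Suc k)
  define z' where "z' = z * cis (2 * pi / real n) ^ k"
  have polar: "polar r \<theta> = vec_of_complex (rcis r \<theta>)" for r \<theta>
    by (simp add: polar_def vec_of_complex_def)
  have "cmod z' \<in> {0..1}"
    using z by (simp add: z'_def norm_mult norm_power)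
  with g[unfolded n_mode_def polar]
  have "g (vec_of_complex (rcis (cmod z') (Arg z'))) =
      g (vec_of_complex (rcis (cmod z') (Arg z' + 2 * pi / real n)))"
    by blast
  also have "rcis (cmod z') (Arg z' + 2 * pi / real n) = z' * cis (2 * pi / real n)"
    by (metis cis_mult mult.assoc rcis_cmod_Arg rcis_def)
  finally show ?case
    using Suc by (simp add: rcis_cmod_Arg z'_def mult_ac)
qed simp

lemma n_mode_eq_of_power_eq:
  assumes g: "n_mode n g" and n: "n > 0" and z: "cmod z \<le> 1" and eq: "z ^ n = z' ^ n"
  shows "g (vec_of_complex z) = g (vec_of_complex z')"
proof (cases "z = 0")
  case True
  then have "z' = 0"
    using eq n by (simp add: power_0_left)
  with True show ?thesis
    by simp
next
  case False
  then have "(z' / z) ^ n = 1"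
    by (simp add: power_divide flip: eq)
  then have "z' / z \<in> (\<lambda>k. cis (2 * pi * real k / real n)) ` {..<n}"
    using bij_betw_imp_surj_on[OF Complex.bij_betw_roots_unity[OF n]] by simp
  then obtain k where "z' / z = cis (2 * pi * real k / real n)"
    by blast
  moreover have "cis (2 * pi / real n) ^ k = cis (2 * pi * real k / real n)"
    by (simp add: Complex.DeMoivre mult_ac)
  ultimately have "z' = z * cis (2 * pi / real n) ^ k"
    using False by (simp add: field_simps)
  then show ?thesis
    using n_mode_rotation[OF g z] by simp
qed

text \<open>The root itself is discontinuous. Because \<open>U\<close> is constant on fibres, the
  preimage of a closed set under the composition is the image under \<open>z \<mapsto> z ^ n\<close>
  of a compact set, hence closed.\<close>

lemma continuous_on_nth_root:
  assumes U: "continuous_on (cball 0 1) U" and n: "n > 0"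
    and inv: "\<And>z z'. cmod z \<le> 1 \<Longrightarrow> z ^ n = z' ^ n \<Longrightarrow> U z = U z'"
  shows "continuous_on (cball 0 1) (\<lambda>x. U (nth_root n x))"
proof -
  have "closed ((\<lambda>x. U (nth_root n x)) -` B \<inter> cball 0 1)" if "closed B" for B
  proof -
    have "compact (U -` B \<inter> cball 0 1)"
      using U that by (metis closed_Int closed_cball closed_vimage_Int compact_Int_closed compact_cball inf_commute inf_left_idem continuous_on_closed_vimage)
    then have "compact ((\<lambda>z. z ^ n) ` (U -` B \<inter> cball 0 1))"
      by (intro compact_continuous_image continuous_intros)
    moreover have "(\<lambda>z. z ^ n) ` (U -` B \<inter> cball 0 1) = (\<lambda>x. U (nth_root n x)) -` B \<inter> cball 0 1"
    proof (intro equalityI subsetI)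
      fix x assume "x \<in> (\<lambda>z. z ^ n) ` (U -` B \<inter> cball 0 1)"
      then obtain z where z: "x = z ^ n" "U z \<in> B" "cmod z \<le> 1"
        by auto
      then have "U z = U (nth_root n x)"
        using n by (intro inv) (auto simp: nth_root_power)
      then show "x \<in> (\<lambda>x. U (nth_root n x)) -` B \<inter> cball 0 1"
        using z by (simp add: norm_power power_le_one)
    next
      fix x assume x: "x \<in> (\<lambda>x. U (nth_root n x)) -` B \<inter> cball 0 1"
      then have "cmod (nth_root n x) \<le> 1"
        using n by (simp add: cmod_nth_root)
      with x show "x \<in> (\<lambda>z. z ^ n) ` (U -` B \<inter> cball 0 1)"
        using n by (intro image_eqI[of _ _ "nth_root n x"]) (auto simp: nth_root_power)
    qed
    ultimately show ?thesis
      by (simp add: compact_imp_closed)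
  qed
  then show ?thesis
    by (simp add: continuous_on_closed_vimage)
qed

text \<open>Near \<open>x\<close> the root may be replaced by a holomorphic branch through the same
  value, since the two differ by a root of unity that \<open>U\<close> does not see. Then the
  conformal change of variables applies.\<close>

lemma has_laplacian_nth_root:
  assumes U: "has_laplacian U L (nth_root n x)" and n: "n > 0" and x: "x \<noteq> 0" "cmod x < 1"
    and inv: "\<And>z z'. cmod z \<le> 1 \<Longrightarrow> z ^ n = z' ^ n \<Longrightarrow> U z = U z'"
  shows "has_laplacian (\<lambda>x. U (nth_root n x))
    (root n (cmod x) powi (2 - 2 * int n) / (real n)\<^sup>2 * L) x"
proof -
  define z where "z = nth_root n x"
  have zn: "z ^ n = x"
    using n by (simp add: z_def nth_root_power)
  then have z: "z \<noteq> 0"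
    using x n by (auto simp: power_0_left)
  \<comment> \<open>The radius keeps the ball inside the unit disc, where \<open>inv\<close> is
    available, and inside the disc about \<open>x\<close> that misses \<open>0\<close>, where the
    branch is holomorphic.\<close>
  define S where "S = ball x (min (cmod x) (1 - cmod x))"
  have S: "open S" "x \<in> S"
    using x by (auto simp: S_def)
  define \<phi> where "\<phi> = (\<lambda>y. z * exp (Ln (y / x) / of_nat n))"
  have pos: "Re (y / x) > 0" if "y \<in> S" for y
  proof -
    have "cmod ((y - x) / x) < 1"
      using that x by (simp add: S_def norm_divide dist_norm norm_minus_commute)
    then have "\<bar>Re ((y - x) / x)\<bar> < 1"
      using abs_Re_le_cmod by (rule le_less_trans[rotated])
    moreover have "y / x = 1 + (y - x) / x"
      using x by (simp add: field_simps)
    ultimately show ?thesis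
      by simp
  qed
  then have hol: "\<phi> holomorphic_on S"
    unfolding \<phi>_def using x n
    by (intro holomorphic_intros) (force simp: complex_nonpos_Reals_iff)+
  have \<phi>_power: "\<phi> y ^ n = y" if "y \<in> S" for y
  proof -
    have "y / x \<noteq> 0"
      using pos[OF that] by auto
    have "\<phi> y ^ n = x * exp (of_nat n * (Ln (y / x) / of_nat n))"
      by (simp only: \<phi>_def power_mult_distrib zn exp_of_nat_mult)
    also have "\<dots> = x * (y / x)"
      using n \<open>y / x \<noteq> 0\<close> by simp
    finally show ?thesis
      using x by simp
  qed
  have \<phi>x: "\<phi> x = z"
    using x by (simp add: \<phi>_def)
  have "(\<phi> has_field_derivative z / (of_nat n * x)) (at x)"
    unfolding \<phi>_def using x n
    by (auto intro!: derivative_eq_intros simp: complex_nonpos_Reals_iff)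
  then have "deriv \<phi> x = z / (of_nat n * x)"
    by (rule DERIV_imp_deriv)
  then have "cmod (deriv \<phi> x) = cmod z / (real n * cmod z ^ n)"
    by (simp add: norm_divide norm_mult norm_power flip: zn)
  then have "(cmod (deriv \<phi> x))\<^sup>2 = cmod z ^ 2 / cmod z ^ (2 * n) / (real n)\<^sup>2"
    by (simp add: power_divide power_mult_distrib mult.commute flip: power_mult)
  also have "cmod z ^ 2 / cmod z ^ (2 * n) = cmod z powi (2 - 2 * int n)"
  proof -
    have "cmod z powi (2 - 2 * int n) = cmod z powi (int 2 - int (2 * n))"
      by simp
    also have "\<dots> = cmod z powi int 2 / cmod z powi int (2 * n)"
      using z by (intro power_int_diff) auto
    finally show ?thesis
      by (simp only: power_int_of_nat)
  qed
  also have "cmod z = root n (cmod x)"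
    using n by (simp add: z_def cmod_nth_root)
  finally have deriv: "(cmod (deriv \<phi> x))\<^sup>2 = root n (cmod x) powi (2 - 2 * int n) / (real n)\<^sup>2" .
  have "has_laplacian (\<lambda>y. U (\<phi> y)) (root n (cmod x) powi (2 - 2 * int n) / (real n)\<^sup>2 * L) x"
    unfolding deriv[symmetric] using U hol S
    by (intro has_laplacian_compose_holomorphic) (simp_all add: \<phi>x z_def)
  then show ?thesis
  proof (rule has_laplacian_cong)
    show "\<forall>\<^sub>F y in nhds x. U (nth_root n y) = U (\<phi> y)"
      using eventually_nhds_in_open[OF S]
    proof eventually_elim
      case (elim y)
      have "cmod y \<le> 1"
        using elim norm_triangle_ineq2[of y x] by (simp add: S_def dist_norm norm_minus_commute)
      then show ?case
        using n \<phi>_power[OF elim] by (intro inv) (simp_all add: nth_root_power cmod_nth_root)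
    qed
  qed
qed

theorem theorem1p1:
  fixes n :: nat
    and f :: "'m::finite \<Rightarrow> real \<Rightarrow> real ^ 'm \<Rightarrow> real"
    and u :: "'m \<Rightarrow> real ^ 2 \<Rightarrow> real"
  assumes m: "CARD('m) \<ge> 2" and n: "n \<ge> 2"
    and f_cont: "\<And>i. continuous_on ({0<..<1} \<times> pos_orthant) (\<lambda>(r, v). f i r v)"
    and f_mono: "\<And>i v. v \<in> pos_orthant \<Longrightarrow>
                   antimono_on {0<..<1} (\<lambda>r. r powi (2 - 2 * int n) * f i r v)"
    and f_C1: "\<And>i r. r \<in> {0<..<1} \<Longrightarrow> Ck_on 1 pos_orthant (f i r)"
    and f_coop: "\<And>i j r v. i \<noteq> j \<Longrightarrow> r \<in> {0<..<1} \<Longrightarrow> v \<in> pos_orthant \<Longrightarrow>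
                   pderiv_at j (f i r) v \<ge> 0"
    and f_bdd: "\<And>i j r0 M. r0 \<in> {0<..<1} \<Longrightarrow> 0 < M \<Longrightarrow>
                  bdd_above {\<bar>pderiv_at j (f i r) v\<bar> | r v. r \<in> {r0<..<1} \<and> (\<forall>k. v $ k \<in> {0<..M})}"
    and u_C2: "\<And>i. Ck_on 2 (ball 0 1 - {0}) (u i)"
    and u_cont: "\<And>i. continuous_on (cball 0 1) (u i)"
    and u_eq: "\<And>i x. x \<in> ball 0 1 - {0} \<Longrightarrow>
                 laplacian (u i) x + f i (norm x) (\<chi> j. u j x) = 0"
    and u_bdry: "\<And>i x. x \<in> sphere 0 1 \<Longrightarrow> u i x = 0"
    and u_mode: "\<And>i. n_mode n (u i)"
    and u_pos: "\<And>i x. x \<in> ball 0 1 \<Longrightarrow> u i x > 0"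
    and u_Cn: "\<And>i. Ck_at n 0 (u i)"
  shows "\<forall>i. \<exists>U :: real \<Rightarrow> real.
           (\<forall>x\<in>cball 0 1. u i x = U (norm x)) \<and>
           (\<forall>r\<in>{0<..<1}. \<exists>d<0. (U has_real_derivative d) (at r))"
proof -
  have n0: "n > 0"
    using n by simp
  define U where "U = (\<lambda>i z. u i (vec_of_complex z))"
  define V where "V = (\<lambda>i x. U i (nth_root n x))"
  define g where "g = (\<lambda>i r v. root n r powi (2 - 2 * int n) / (real n)\<^sup>2 * f i (root n r) v)"
  have inv: "U i z = U i z'" if "cmod z \<le> 1" "z ^ n = z' ^ n" for i z z'
    unfolding U_def using n_mode_eq_of_power_eq[OF u_mode n0 that] .
  have V_power: "V i (z ^ n) = U i z" if "cmod z \<le> 1" for i z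
    using inv[OF that, of "nth_root n (z ^ n)" i] n0 by (simp add: V_def nth_root_power)
  have f_lip: "\<exists>B\<ge>0. \<forall>i r a b. r0 < r \<longrightarrow> r < 1 \<longrightarrow> (\<forall>k. a $ k \<in> {0<..M}) \<longrightarrow> (\<forall>k. b $ k \<in> {0<..M}) \<longrightarrow>
      f i r a - f i r b \<ge> - B * (\<bar>a $ i - b $ i\<bar> + (\<Sum>j\<in>UNIV. max 0 (b $ j - a $ j)))"
    if r0: "0 < r0" "r0 < 1" and M: "0 < M" for r0 M
  proof -
    define bd where "bd = (\<lambda>i j B. \<forall>r v. r \<in> {r0<..<1} \<longrightarrow> (\<forall>k. v $ k \<in> {0<..M}) \<longrightarrow>
      \<bar>pderiv_at j (f i r) v\<bar> \<le> B)"
    have "\<exists>B. bd i j B" for i j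
    proof -
      have "bdd_above {\<bar>pderiv_at j (f i r) v\<bar> | r v. r \<in> {r0<..<1} \<and> (\<forall>k. v $ k \<in> {0<..M})}"
        using r0 M by (intro f_bdd) auto
      then show ?thesis
        unfolding bdd_above_def bd_def by blast
    qed
    then obtain B where B: "\<And>i j. bd i j (B i j)"
      by metis
    define B' where "B' = (\<Sum>(i, j)\<in>UNIV. \<bar>B i j\<bar>)"
    have B_le: "B i j \<le> B'" for i j
    proof -
      have "\<bar>B i j\<bar> \<le> B'"
        unfolding B'_def using member_le_sum[of "(i, j)" UNIV "\<lambda>(i, j). \<bar>B i j\<bar>"] by auto
      then show ?thesis
        by simp
    qed
    show ?thesis
    proof (intro exI[of _ B'] conjI allI impI)
      show "B' \<ge> 0"
        by (auto simp: B'_def intro!: sum_nonneg)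
      fix i r and a b :: "real ^ 'm"
      assume r: "r0 < r" "r < 1" and a: "\<forall>k. a $ k \<in> {0<..M}" and b: "\<forall>k. b $ k \<in> {0<..M}"
      have r': "r \<in> {0<..<1}" "r \<in> {r0<..<1}"
        using r r0 by auto
      show "f i r a - f i r b \<ge> - B' * (\<bar>a $ i - b $ i\<bar> + (\<Sum>j\<in>UNIV. max 0 (b $ j - a $ j)))"
      proof (rule cooperative_increment)
        show "(\<lambda>t. f i r (v + t *\<^sub>R axis j 1)) differentiable (at 0)" if "v \<in> pos_orthant" for j v
          using f_C1[OF r'(1), of i] that by simp
        show "pderiv_at j (f i r) v \<ge> 0" if "j \<noteq> i" "v \<in> pos_orthant" for j v
          using f_coop[OF that(1)[symmetric] r'(1) that(2)] .
        show "\<bar>pderiv_at j (f i r) v\<bar> \<le> B'" if "\<And>k. v $ k \<in> {0<..M}" for j and v :: "real ^ 'm"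
          using B[of i j, unfolded bd_def, rule_format, OF r'(2) that] B_le[of i j] by linarith
      qed (use a b in auto)
    qed
  qed
  interpret cooperative_system_on_disc V g
  proof
    fix i
    have "continuous_on (cball 0 1) (U i)"
      unfolding U_def
      by (rule continuous_on_compose2[OF u_cont continuous_on_vec_of_complex]) auto
    then show "continuous_on (cball 0 1) (V i)"
      unfolding V_def using n0 inv by (intro continuous_on_nth_root) auto
    show "V i x = 0" if "cmod x = 1" for x
      using that n0 u_bdry[of "vec_of_complex (nth_root n x)" i] by (simp add: V_def U_def cmod_nth_root)
    show "V i x > 0" if "cmod x < 1" for x
      using that n0 u_pos[of "vec_of_complex (nth_root n x)" i] by (simp add: V_def U_def cmod_nth_root)
    show "has_laplacian (V i) (- g i (cmod x) (\<chi> j. V j x)) x" if x: "cmod x < 1" "x \<noteq> 0" for x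
    proof -
      define z where "z = nth_root n x"
      have "cmod z < 1" "z \<noteq> 0"
        using x n0 nth_root_power[OF n0, of x] by (auto simp: z_def cmod_nth_root power_0_left)
      then have z: "vec_of_complex z \<in> ball 0 1 - {0}"
        by simp
      have "has_laplacian (U i) (laplacian (u i) (vec_of_complex z)) z"
        unfolding U_def using z by (intro has_laplacian_if_Ck_on_2[OF u_C2]) auto
      also have "laplacian (u i) (vec_of_complex z) = - f i (root n (cmod x)) (\<chi> j. V j x)"
        using u_eq[OF z, of i] n0 by (simp add: V_def U_def z_def cmod_nth_root)
      finally have "has_laplacian (V i) (root n (cmod x) powi (2 - 2 * int n) / (real n)\<^sup>2 *
          - f i (root n (cmod x)) (\<chi> j. V j x)) x"
        unfolding V_def z_def using n0 x inv by (intro has_laplacian_nth_root) auto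
      then show ?thesis
        by (simp add: g_def)
    qed
    show "g i s v \<le> g i r v" if "v \<in> pos_orthant" "0 < r" "r \<le> s" "s < 1" for v r s
    proof -
      have "root n s powi (2 - 2 * int n) * f i (root n s) v \<le>
          root n r powi (2 - 2 * int n) * f i (root n r) v"
        using monotone_onD[OF f_mono[OF that(1), of i], of "root n r" "root n s"] that n0 by simp
      then show ?thesis
        by (simp add: g_def divide_right_mono)
    qed
  next
    fix r0 M :: real assume r0: "0 < r0" "r0 < 1" and M: "0 < M"
    define r1 where "r1 = root n r0"
    have r1: "0 < r1" "r1 < 1"
      using r0 n0 by (auto simp: r1_def)
    obtain B where B: "B \<ge> 0" and lip: "\<forall>i r a b. r1 < r \<longrightarrow> r < 1 \<longrightarrow> (\<forall>k. a $ k \<in> {0<..M}) \<longrightarrow>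
       (\<forall>k. b $ k \<in> {0<..M}) \<longrightarrow>
      f i r a - f i r b \<ge> - B * (\<bar>a $ i - b $ i\<bar> + (\<Sum>j\<in>UNIV. max 0 (b $ j - a $ j)))"
      using f_lip[OF r1 M] by blast
    \<comment> \<open>The exponent is negative because \<open>n \<ge> 2\<close>, so this conformal
      factor decreases in the radius and its value at \<open>r1\<close> bounds it on all larger
      radii.\<close>
    define c where "c = (\<lambda>r. r powi (2 - 2 * int n) / (real n)\<^sup>2)"
    show "\<exists>L\<ge>0. \<forall>i r a b. r0 < r \<longrightarrow> r < 1 \<longrightarrow> (\<forall>k. a $ k \<in> {0<..M}) \<longrightarrow> (\<forall>k. b $ k \<in> {0<..M}) \<longrightarrow>
        g i r a - g i r b \<ge> - L * (\<bar>a $ i - b $ i\<bar> + (\<Sum>j\<in>UNIV. max 0 (b $ j - a $ j)))"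
    proof (intro exI[of _ "c r1 * B"] conjI allI impI)
      show "0 \<le> c r1 * B"
        using r1 B by (simp add: c_def)
      fix i r and a b :: "real ^ 'm"
      assume r: "r0 < r" "r < 1" and a: "\<forall>k. a $ k \<in> {0<..M}" and b: "\<forall>k. b $ k \<in> {0<..M}"
      define Y where "Y = \<bar>a $ i - b $ i\<bar> + (\<Sum>j\<in>UNIV. max 0 (b $ j - a $ j))"
      have Y: "Y \<ge> 0"
        by (simp add: Y_def sum_nonneg)
      have rr: "r1 < root n r" "root n r < 1"
        using r r0 n0 by (auto simp: r1_def)
      have c_le: "0 \<le> c (root n r)" "c (root n r) \<le> c r1"
      proof -
        have "root n r powi (2 - 2 * int n) \<le> r1 powi (2 - 2 * int n)"
          using rr r1 n by (intro power_int_antimono) auto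
        then show "c (root n r) \<le> c r1"
          by (simp add: c_def divide_right_mono)
      qed (use rr r1 in \<open>simp add: c_def\<close>)
      have "- (c r1 * B) * Y \<le> c (root n r) * (- B * Y)"
        using mult_right_mono[OF c_le(2), of "B * Y"] B Y by (simp add: mult.assoc)
      also have "\<dots> \<le> c (root n r) * (f i (root n r) a - f i (root n r) b)"
        using lip rr a b c_le(1) by (intro mult_left_mono) (auto simp: Y_def)
      also have "\<dots> = g i r a - g i r b"
        by (simp only: g_def c_def right_diff_distrib)
      finally show "g i r a - g i r b \<ge> - (c r1 * B) * (\<bar>a $ i - b $ i\<bar> + (\<Sum>j\<in>UNIV. max 0 (b $ j - a $ j)))"
        by (simp add: Y_def)
    qed
  qed
  show ?thesis
  \<comment> \<open>The radial profile, left schematic here, is fixed by the first goal: the values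
    of \<open>U i\<close> on the positive real axis.\<close>
  proof (rule allI, rule exI, intro conjI ballI)
    fix i
    show "u i x = U i (of_real (norm x))" if "x \<in> cball 0 1" for x
    proof -
      define z where "z = Complex (x $ 1) (x $ 2)"
      have x: "x = vec_of_complex z"
        by (simp add: vec_of_complex_def z_def vec_eq_iff forall_2)
      then have z: "cmod z \<le> 1"
        using that by simp
      have "U i z = V i (z ^ n)"
        using V_power z by simp
      also have "\<dots> = V i (of_real (cmod z) ^ n)"
        using z by (intro V_radial) (auto simp: norm_power power_le_one)
      also have "\<dots> = U i (of_real (cmod z))"
        using V_power z by simp
      finally show ?thesis
        by (simp add: U_def x)
    qed
    fix r :: real assume r: "r \<in> {0<..<1}"
    \<comment> \<open>Radius \<open>r\<close> for \<open>u\<close> is radius \<open>r ^ n\<close>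
      for \<open>V\<close>. The chain rule contributes \<open>real n * r ^ (n - 1)\<close>, positive
      because \<open>r > 0\<close>, so the sign of \<open>d\<close> is preserved.\<close>
    obtain d where d: "d < 0" "((\<lambda>t. V i (of_real t)) has_real_derivative d) (at (r ^ n))"
      using V_radial_derivative_neg[of "r ^ n" i] r n0 by (auto simp: power_less_one_iff)
    have "((\<lambda>t. t ^ n) has_real_derivative real n * r ^ (n - 1)) (at r)"
      by (auto intro!: derivative_eq_intros)
    from DERIV_chain2[OF d(2) this]
    have "((\<lambda>t. V i (of_real (t ^ n))) has_real_derivative d * (real n * r ^ (n - 1))) (at r)" .
    then have "((\<lambda>t. U i (of_real t)) has_real_derivative d * (real n * r ^ (n - 1))) (at r)"
    proof (rule has_field_derivative_transform_within_open)
      show "V i (of_real (t ^ n)) = U i (of_real t)" if "t \<in> {0<..<1}" for t :: real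
        using V_power[of "of_real t" i] that by simp
    qed (use r in auto)
    moreover have "d * (real n * r ^ (n - 1)) < 0"
      using d(1) r n0 by (intro mult_neg_pos) auto
    ultimately show "\<exists>d<0. ((\<lambda>t. U i (of_real t)) has_real_derivative d) (at r)"
      by blast
  qed
qed

end
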